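(* Let $b\ge1$. As $m,n\to\infty$ with $n/(bm)\to\alpha\in(0,1)$, $B_{m,n}\to B_\alpha$ in distribution, with convergence of all moments.
   Context: Exact model: $m$ cyclically arranged buckets of capacity $b$, $n<bm$ labelled keys, all $m^n$ assignments of hash addresses equally likely, keys placed by linear probing with wrap-around. A block is a maximal run of consecutive full buckets followed by a non-full bucket. $B_{m,n}$ is the length of a block chosen uniformly at random among all blocks in all $m^n$ hash tables with $m$ buckets and $n$ keys. $B_\alpha=\min\{i\ge1:X_1+\dots+X_i<bi\}$, where $X_1,X_2,\dots$ are i.i.d. Poisson with mean $\alpha b$. *)

theory Defs
  imports "HOL-Probability.Probability"
begin

text \<open>
  Buckets are \<open>0, \<dots>, m - 1\<close>, cyclically arranged, each of capacity \<open>b\<close>; keys are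
  \<open>0, \<dots>, n - 1\<close>, inserted in this order; \<open>h k\<close> is the hash address of key \<open>k\<close>.
  A table maps each bucket to the set of keys stored in it.
\<close>

definition probe :: "nat \<Rightarrow> nat \<Rightarrow> (nat \<Rightarrow> nat set) \<Rightarrow> nat \<Rightarrow> nat" where
  "probe b m T a = (a + (LEAST j. card (T ((a + j) mod m)) < b)) mod m"

primrec hash_table :: "nat \<Rightarrow> nat \<Rightarrow> (nat \<Rightarrow> nat) \<Rightarrow> nat \<Rightarrow> (nat \<Rightarrow> nat set)" where
  "hash_table b m h 0 = (\<lambda>_. {})"
| "hash_table b m h (Suc k) =
     (let T = hash_table b m h k; i = probe b m T (h k) in T(i := insert k (T i)))"

definition full :: "nat \<Rightarrow> (nat \<Rightarrow> nat set) \<Rightarrow> nat \<Rightarrow> bool" where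
  "full b T i \<longleftrightarrow> card (T i) = b"

text \<open>
  A pair \<open>(s, l)\<close> denotes the block consisting of the \<open>l\<close> buckets \<open>s, \<dots>, s + l - 1\<close> (modulo \<open>m\<close>):
  the first \<open>l - 1\<close> (possibly none) are full, the last is not, and the run of full buckets is
  maximal because the bucket cyclically preceding \<open>s\<close> is not full. The length of a block counts
  its final non-full bucket. If there is only one non-full bucket, it both ends and precedes the
  unique block, which then has length \<open>m\<close>.
\<close>

definition blocks :: "nat \<Rightarrow> nat \<Rightarrow> (nat \<Rightarrow> nat set) \<Rightarrow> (nat \<times> nat) set" where
  "blocks b m T = {(s, l). s < m \<and> 1 \<le> l \<and> l \<le> m \<and>
      \<not> full b T ((s + m - 1) mod m) \<and>
      (\<forall>i < l - 1. full b T ((s + i) mod m)) \<and>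
      \<not> full b T ((s + l - 1) mod m)}"

definition all_blocks :: "nat \<Rightarrow> nat \<Rightarrow> nat \<Rightarrow> ((nat \<Rightarrow> nat) \<times> nat \<times> nat) set" where
  "all_blocks b m n =
     (SIGMA h : {0..<n} \<rightarrow>\<^sub>E {0..<m}. blocks b m (hash_table b m h n))"

text \<open>
  The law of \<open>B\<^sub>m\<^sub>,\<^sub>n\<close>. The uniform choice is among all blocks of all tables together,
  so a table is weighted by its number of blocks.
\<close>

definition block_length_pmf :: "nat \<Rightarrow> nat \<Rightarrow> nat \<Rightarrow> nat pmf" where
  "block_length_pmf b m n = map_pmf (\<lambda>(h, s, l). l) (pmf_of_set (all_blocks b m n))"

text \<open>
  The random variable \<open>B\<^sub>\<alpha>\<close>, as a functional of the sequence \<open>X\<^sub>1, X\<^sub>2, \<dots>\<close> (the value at index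
  \<open>0\<close> is not used). If no \<open>i\<close> qualifies, the infimum in \<open>nat\<close> is \<open>0\<close>, a value not otherwise
  attained.
\<close>

definition B_lim :: "nat \<Rightarrow> (nat \<Rightarrow> 'a \<Rightarrow> nat) \<Rightarrow> 'a \<Rightarrow> nat" where
  "B_lim b X \<omega> = Inf {i. 1 \<le> i \<and> (\<Sum>j = 1..i. X j \<omega>) < b * i}"

end

theory Submission
  imports Defs "HOL-Number_Theory.Cong"
begin

text \<open>
  A bucket is not full in the final table iff every arc of \<open>j\<close> buckets ending there receives fewer
  than \<open>b j\<close> hash addresses. If the bucket before \<open>s\<close> is not full, no key flows into \<open>s\<close>, so the
  block starting at \<open>s\<close> has length \<open>l\<close> iff \<open>l\<close> is the first \<open>i\<close> for which the \<open>i\<close> buckets from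
  \<open>s\<close> on receive fewer than \<open>b i\<close> addresses. By rotation invariance the law of the block length is
  that of this passage time for a fixed \<open>s\<close>, conditioned on no inflow into \<open>s\<close>.

  A Chernoff bound makes it exponentially unlikely, uniformly in \<open>m\<close>, that \<open>j\<close> buckets receive at
  least \<open>b j\<close> addresses. So the no-inflow condition may be truncated to the \<open>J\<close> buckets before
  \<open>s\<close>; the truncated condition and the passage time depend on disjoint finite sets of buckets,
  whose loads become independent Poisson variables, and the condition cancels in the limit.
  The same bound dominates the block length by a geometric law, which gives convergence of all
  moments and shows that the limiting weights sum to 1.
\<close>

section \<open>Block lengths as passage times\<close>

definition bucket_arc :: "nat \<Rightarrow> nat \<Rightarrow> nat \<Rightarrow> nat set" where
  "bucket_arc m s j = (\<lambda>i. (s + i) mod m) ` {..<j}"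

definition load :: "nat \<Rightarrow> (nat \<Rightarrow> nat) \<Rightarrow> nat set \<Rightarrow> nat" where
  "load n h A = card {k. k < n \<and> h k \<in> A}"

definition load_passage :: "nat \<Rightarrow> nat \<Rightarrow> nat \<Rightarrow> nat \<Rightarrow> (nat \<Rightarrow> nat) \<Rightarrow> nat \<Rightarrow> bool" where
  "load_passage b m n s h l \<longleftrightarrow> 1 \<le> l \<and> l \<le> m \<and> load n h (bucket_arc m s l) < b * l \<and>
     (\<forall>i. 1 \<le> i \<longrightarrow> i < l \<longrightarrow> b * i \<le> load n h (bucket_arc m s i))"

text \<open>
  The arc of \<open>j\<close> buckets ending just before \<open>s\<close> starts at \<open>s + m - j\<close>, where \<open>m\<close> prevents truncated
  subtraction. Only \<open>J = m\<close> expresses that no key flows into \<open>s\<close>; smaller \<open>J\<close> give the truncated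
  condition.
\<close>
definition no_inflow :: "nat \<Rightarrow> nat \<Rightarrow> nat \<Rightarrow> nat \<Rightarrow> nat \<Rightarrow> (nat \<Rightarrow> nat) \<Rightarrow> bool" where
  "no_inflow J b m n s h \<longleftrightarrow> (\<forall>j. 1 \<le> j \<longrightarrow> j \<le> J \<longrightarrow> load n h (bucket_arc m (s + m - j) j) < b * j)"

section \<open>Arithmetic of cyclic arcs\<close>

lemma mod_add_right_inj:
  fixes a i j m :: nat
  assumes "(a + i) mod m = (a + j) mod m" "i < m" "j < m"
  shows "i = j"
proof -
  have "[a + i = a + j] (mod m)" using assms(1) by (simp add: cong_def)
  then have "[i = j] (mod m)" by (simp add: cong_add_lcancel_nat)
  then show ?thesis using assms by (simp add: cong_def)
qed

lemma inj_on_bucket_arc: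
  fixes s j m :: nat
  assumes "j \<le> m"
  shows "inj_on (\<lambda>i. (s + i) mod m) {..<j}"
proof (rule inj_onI)
  fix x y assume xy: "x \<in> {..<j}" "y \<in> {..<j}" and eq: "(s + x) mod m = (s + y) mod m"
  have "x < m" "y < m" using xy assms by auto
  then show "x = y" by (rule mod_add_right_inj[OF eq])
qed

lemma card_bucket_arc: "j \<le> m \<Longrightarrow> card (bucket_arc m s j) = j"
  unfolding bucket_arc_def by (simp add: card_image inj_on_bucket_arc)

lemma bucket_arc_subset: "0 < m \<Longrightarrow> bucket_arc m s j \<subseteq> {..<m}"
  by (auto simp: bucket_arc_def)

lemma bucket_arc_mod: "bucket_arc m (s mod m) j = bucket_arc m s j"
  by (simp add: bucket_arc_def mod_simps)

lemma exists_offset: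
  fixes m a c :: nat
  assumes "a < m"
  obtains j where "j < m" "(c + j) mod m = a"
proof -
  have "inj_on (\<lambda>i. (c + i) mod m) {..<m}" by (rule inj_on_bucket_arc) simp
  then have "(\<lambda>i. (c + i) mod m) ` {..<m} = {..<m}"
    using assms by (intro card_subset_eq) (auto simp: card_image)
  then have "a \<in> (\<lambda>i. (c + i) mod m) ` {..<m}" using assms by simp
  then show ?thesis using that by auto
qed

section \<open>The invariant kept by linear probing\<close>

definition probe_inv :: "nat \<Rightarrow> nat \<Rightarrow> (nat \<Rightarrow> nat) \<Rightarrow> nat \<Rightarrow> (nat \<Rightarrow> nat set) \<Rightarrow> bool" where
  "probe_inv b m h k T \<longleftrightarrow> (\<forall>i. T i \<subseteq> {..<k} \<and> card (T i) \<le> b) \<and> (\<Union>i<m. T i) = {..<k}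
     \<and> disjoint_family T
     \<and> (\<forall>i. \<forall>x\<in>T i. \<exists>d<m. i = (h x + d) mod m \<and> (\<forall>d'<d. card (T ((h x + d') mod m)) = b))"

lemma sum_card_table:
  assumes "probe_inv b m h k T"
  shows "(\<Sum>i<m. card (T i)) = k"
proof -
  have "card (\<Union>i\<in>{..<m}. T i) = (\<Sum>i<m. card (T i))"
  proof (rule card_UN_disjoint)
    show "\<forall>i\<in>{..<m}. finite (T i)"
      using assms by (meson finite_lessThan finite_subset probe_inv_def)
    show "\<forall>i\<in>{..<m}. \<forall>j\<in>{..<m}. i \<noteq> j \<longrightarrow> T i \<inter> T j = {}"
      using assms by (simp add: probe_inv_def disjoint_family_on_def)
  qed simp
  then show ?thesis using assms by (simp add: probe_inv_def)
qed

lemma ex_nonfull: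
  assumes "probe_inv b m h k T" "k < b * m"
  obtains a where "a < m" "card (T a) < b"
proof -
  have "\<exists>a<m. card (T a) < b"
  proof (rule ccontr)
    assume "\<not> ?thesis"
    then have "(\<Sum>i<m. b) \<le> (\<Sum>i<m. card (T i))" by (intro sum_mono) auto
    with assms show False by (simp add: sum_card_table mult.commute)
  qed
  then show ?thesis using that by blast
qed

text \<open>Insertion preserves the probe-path clause: a new key passes only full buckets, and full
  buckets stay full because keys are never removed and a full bucket is never chosen.\<close>

lemma probe_inv_hash_table:
  assumes "k \<le> b * m"
  shows "probe_inv b m h k (hash_table b m h k)"
  using assms
proof (induction k)
  case 0
  then show ?case by (auto simp: probe_inv_def disjoint_family_on_def)
next
  case (Suc k)
  define T where "T = hash_table b m h k"
  have inv: "probe_inv b m h k T" using Suc by (simp add: T_def)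
  have fin: "finite (T i)" for i
    using inv by (meson finite_lessThan finite_subset probe_inv_def)
  have sub: "T i \<subseteq> {..<k}" and le: "card (T i) \<le> b" for i
    using inv by (auto simp: probe_inv_def)
  \<comment> \<open>\<open>probe\<close> minimises over all natural offsets. Since
    \<open>k < b * m\<close>, some bucket has room and is reached at an offset below
    \<open>m\<close>, so the minimum is attained and is itself below \<open>m\<close>.\<close>
  obtain a where a: "a < m" "card (T a) < b" using ex_nonfull[OF inv] Suc.prems by auto
  obtain j where j: "j < m" "(h k + j) mod m = a" using exists_offset[OF a(1)] .
  define L where "L = (LEAST j. card (T ((h k + j) mod m)) < b)"
  define i where "i = (h k + L) mod m"
  have i: "i = probe b m T (h k)" by (simp add: i_def L_def probe_def)
  have L: "card (T i) < b" unfolding i_def L_def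
    by (rule LeastI[of _ j]) (use a j in simp)
  have Lm: "L < m" unfolding L_def
    using Least_le[of "\<lambda>j. card (T ((h k + j) mod m)) < b" j] a j by simp
  have im: "i < m" using a by (simp add: i_def)
  have fullL: "card (T ((h k + d) mod m)) = b" if "d < L" for d
    using not_less_Least[OF that[unfolded L_def]] le[of "(h k + d) mod m"] by simp
  define T' where "T' = T(i := insert k (T i))"
  have T': "hash_table b m h (Suc k) = T'" by (simp add: T'_def T_def[symmetric] i Let_def)
  have keep: "card (T' x) = b" if "card (T x) = b" for x using that L by (auto simp: T'_def)
  have kn: "k \<notin> T x" for x using sub[of x] by auto
  have un: "(\<Union>x<m. T x) = {..<k}" using inv by (simp add: probe_inv_def)
  have "(\<Union>x<m. T' x) = insert k (\<Union>x<m. T x)"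
    using im by (auto simp: T'_def split: if_splits)
  then have 1: "(\<Union>x<m. T' x) = {..<Suc k}" using un by auto
  have 2: "T' x \<subseteq> {..<Suc k} \<and> card (T' x) \<le> b" for x
    using sub[of x] le[of x] L fin kn by (auto simp: T'_def)
  have dj: "disjoint_family T" using inv by (simp add: probe_inv_def)
  have 3: "disjoint_family T'"
    using dj kn by (auto simp: disjoint_family_on_def T'_def)
  have 4: "\<exists>d<m. y = (h x + d) mod m \<and> (\<forall>d'<d. card (T' ((h x + d') mod m)) = b)"
    if "x \<in> T' y" for x y
  proof (cases "x = k")
    case True
    then have "y = i" using that kn by (auto simp: T'_def split: if_splits)
    then show ?thesis using True Lm fullL keep i_def by blast
  next
    case False
    then have "x \<in> T y" using that by (auto simp: T'_def split: if_splits)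
    then have "\<exists>d<m. y = (h x + d) mod m \<and> (\<forall>d'<d. card (T ((h x + d') mod m)) = b)"
      using inv by (simp add: probe_inv_def)
    then show ?thesis using keep by blast
  qed
  show ?case unfolding T' probe_inv_def using 1 2 3 4 by blast
qed

section \<open>A single finished table: stored keys against hash addresses\<close>

locale probing =
  fixes b m n :: nat and h :: "nat \<Rightarrow> nat" and T :: "nat \<Rightarrow> nat set"
  assumes room: "n < b * m" and addr: "\<And>k. k < n \<Longrightarrow> h k < m"
    and inv: "probe_inv b m h n T"
begin

lemma m_pos: "0 < m" using room by (cases m) auto

lemma finite_bucket: "finite (T i)"
  using inv by (meson finite_lessThan finite_subset probe_inv_def)

lemma card_bucket_le: "card (T i) \<le> b" using inv by (simp add: probe_inv_def)

lemma full_iff: "\<not> full b T i \<longleftrightarrow> card (T i) < b"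
  using card_bucket_le[of i] by (auto simp: full_def)

lemma stored_card: "j \<le> m \<Longrightarrow> card (\<Union>i\<in>bucket_arc m s j. T i) = (\<Sum>i<j. card (T ((s + i) mod m)))"
proof -
  assume j: "j \<le> m"
  have "card (\<Union>i\<in>bucket_arc m s j. T i) = (\<Sum>i\<in>bucket_arc m s j. card (T i))"
    using inv finite_bucket
    by (intro card_UN_disjoint) (auto simp: bucket_arc_def probe_inv_def disjoint_family_on_def)
  also have "\<dots> = (\<Sum>i<j. card (T ((s + i) mod m)))"
    unfolding bucket_arc_def using inj_on_bucket_arc[OF j] by (subst sum.reindex) auto
  finally show ?thesis .
qed

lemma bucket_of: "x < n \<Longrightarrow> \<exists>i<m. x \<in> T i"
proof -
  assume "x < n"
  then have "x \<in> (\<Union>i<m. T i)" using inv by (simp add: probe_inv_def)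
  then show ?thesis by auto
qed

lemma probe_path:
  "x \<in> T i \<Longrightarrow> x < n \<and> (\<exists>d<m. i = (h x + d) mod m \<and> (\<forall>d'<d. full b T ((h x + d') mod m)))"
  using inv by (auto simp: probe_inv_def full_def)

text \<open>A key hashed into the arc cannot be stored beyond its end: the probe path would pass
  through the last bucket of the arc, which would then be full.\<close>

lemma load_le_stored:
  assumes "\<not> full b T ((s + j - 1) mod m)" "1 \<le> j" "j \<le> m"
  shows "load n h (bucket_arc m s j) \<le> (\<Sum>i<j. card (T ((s + i) mod m)))"
proof -
  have "{k. k < n \<and> h k \<in> bucket_arc m s j} \<subseteq> (\<Union>i\<in>bucket_arc m s j. T i)"
  proof safe
    fix x assume x: "x < n" "h x \<in> bucket_arc m s j"
    then obtain i where i: "h x = (s + i) mod m" "i < j" by (auto simp: bucket_arc_def)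
    obtain p where p: "x \<in> T p" using bucket_of[OF x(1)] by auto
    obtain d where d: "p = (h x + d) mod m" "\<And>d'. d' < d \<Longrightarrow> full b T ((h x + d') mod m)"
      using probe_path[OF p] by auto
    have eq: "(h x + e) mod m = (s + (i + e)) mod m" for e
      by (simp add: i mod_simps add.assoc)
    have "i + d < j"
    proof (rule ccontr)
      assume "\<not> ?thesis"
      then have "j - 1 - i < d" using i assms by simp
      from d(2)[OF this] have "full b T ((s + (i + (j - 1 - i))) mod m)" by (simp only: eq)
      moreover have "s + (i + (j - 1 - i)) = s + j - 1" using i assms by simp
      ultimately show False using assms by simp
    qed
    then have "p \<in> bucket_arc m s j" unfolding bucket_arc_def d(1) eq by blast
    then show "x \<in> (\<Union>i\<in>bucket_arc m s j. T i)" using p by blast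
  qed
  then have "load n h (bucket_arc m s j) \<le> card (\<Union>i\<in>bucket_arc m s j. T i)"
    unfolding load_def by (rule card_mono[rotated]) (auto simp: bucket_arc_def finite_bucket)
  then show ?thesis using stored_card[OF assms(3)] by simp
qed

text \<open>A key stored in the arc but hashed outside it would have entered through the bucket
  preceding \<open>s\<close>, and that bucket would be full.\<close>

lemma stored_le_load:
  assumes "\<not> full b T ((s + m - 1) mod m)" "j \<le> m"
  shows "(\<Sum>i<j. card (T ((s + i) mod m))) \<le> load n h (bucket_arc m s j)"
proof -
  have "(\<Union>i\<in>bucket_arc m s j. T i) \<subseteq> {k. k < n \<and> h k \<in> bucket_arc m s j}"
  proof safe
    fix x p assume p: "x \<in> T p" "p \<in> bucket_arc m s j"
    show xn: "x < n" using probe_path[OF p(1)] by simp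
    obtain i where i: "p = (s + i) mod m" "i < j" using p by (auto simp: bucket_arc_def)
    obtain d where d: "d < m" "p = (h x + d) mod m" "\<And>d'. d' < d \<Longrightarrow> full b T ((h x + d') mod m)"
      using probe_path[OF p(1)] by auto
    have c: "[h x + d = s + i] (mod m)" using i d by (simp add: cong_def)
    show "h x \<in> bucket_arc m s j"
    proof (cases "d \<le> i")
      case True
      then have "[h x + d = (s + (i - d)) + d] (mod m)" using c by simp
      then have "[h x = s + (i - d)] (mod m)" using cong_add_rcancel_nat by blast
      then have "h x = (s + (i - d)) mod m" using addr[OF xn] by (simp add: cong_def)
      then show ?thesis using i unfolding bucket_arc_def by force
    next
      case False
      \<comment> \<open>The probe path is longer than the distance \<open>i\<close> back to
        \<open>s\<close>, so at offset \<open>d - i - 1\<close> it visits the bucket preceding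
        \<open>s\<close>.\<close>
      have "[(h x + (d - i - 1)) + (i + 1) = h x + d] (mod m)" using False by simp
      also have "[h x + d = s + i] (mod m)" by (rule c)
      also have "[s + i = s + m - 1 + (i + 1)] (mod m)"
      proof -
        have "s + m - 1 + (i + 1) = s + i + m" using m_pos by simp
        then show ?thesis by (simp only: cong_def mod_add_self2)
      qed
      finally have "[h x + (d - i - 1) = s + m - 1] (mod m)" using cong_add_rcancel_nat by blast
      moreover have "full b T ((h x + (d - i - 1)) mod m)" using False by (intro d(3)) simp
      ultimately show ?thesis using assms by (simp add: cong_def)
    qed
  qed
  then have "card (\<Union>i\<in>bucket_arc m s j. T i) \<le> load n h (bucket_arc m s j)"
    unfolding load_def by (rule card_mono[rotated]) auto
  then show ?thesis using stored_card[OF assms(2)] by simp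
qed

text \<open>An arc ending in a bucket with room stores every key hashed into it and yet is not
  filled. Conversely, walk back from a full bucket to the nearest one with room: the full buckets in
  between receive nothing from outside, so their load is at least their capacity.\<close>

lemma nonfull_iff_no_inflow: "\<not> full b T ((s + m - 1) mod m) \<longleftrightarrow> no_inflow m b m n s h"
proof
  assume nf: "\<not> full b T ((s + m - 1) mod m)"
  show "no_inflow m b m n s h"
    unfolding no_inflow_def
  proof safe
    fix j assume j: "1 \<le> j" "j \<le> m"
    have e: "s + m - j + j - 1 = s + m - 1" using j by simp
    have "load n h (bucket_arc m (s + m - j) j) \<le> (\<Sum>i<j. card (T ((s + m - j + i) mod m)))"
      using nf j by (intro load_le_stored) (simp_all add: e)
    also have "\<dots> < (\<Sum>i<j. b)"
    proof (rule sum_strict_mono_ex1)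
      have "s + m - j + (j - 1) = s + m - 1" using j by simp
      then show "\<exists>a\<in>{..<j}. card (T ((s + m - j + a) mod m)) < b"
        using nf j by (intro bexI[of _ "j - 1"]) (simp_all add: full_iff)
    qed (simp_all add: card_bucket_le)
    finally show "load n h (bucket_arc m (s + m - j) j) < b * j" by (simp add: mult.commute)
  qed
next
  assume *: "no_inflow m b m n s h"
  show "\<not> full b T ((s + m - 1) mod m)"
  proof
    assume f: "full b T ((s + m - 1) mod m)"
    obtain a where a: "a < m" "card (T a) < b" using ex_nonfull[OF inv room] .
    obtain e where e: "e < m" "(s + e) mod m = a" using exists_offset[OF a(1)] .
    define P where "P j \<longleftrightarrow> j < m \<and> \<not> full b T ((s + m - 1 - j) mod m)" for j
    \<comment> \<open>The bucket with room found \<open>e\<close> places after \<open>s\<close>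
      lies, going backwards, \<open>m - 1 - e\<close> places before the predecessor of
      \<open>s\<close>; this makes the walk back end within \<open>m\<close> steps.\<close>
    have "s + m - 1 - (m - 1 - e) = s + e" using e by simp
    then have "P (m - 1 - e)" using e a m_pos by (simp add: P_def full_iff)
    then have PL: "P (LEAST j. P j)" by (rule LeastI)
    define L where "L = (LEAST j. P j)"
    have L: "L < m" "\<not> full b T ((s + m - 1 - L) mod m)" using PL by (auto simp: L_def P_def)
    have nL: "full b T ((s + m - 1 - j) mod m)" if "j < L" for j
      using not_less_Least[OF that[unfolded L_def]] that L by (simp add: P_def)
    have "L \<noteq> 0" using L f by (cases L) auto
    have "s + m - L + m - 1 = s + m - 1 - L + m" using L by simp
    then have prev: "(s + m - L + m - 1) mod m = (s + m - 1 - L) mod m" by simp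
    have "card (T ((s + m - L + i) mod m)) = b" if "i < L" for i
    proof -
      have "s + m - L + i = s + m - 1 - (L - 1 - i)" using that L by simp
      then show ?thesis using nL[of "L - 1 - i"] that by (simp add: full_def)
    qed
    then have "b * L = (\<Sum>i<L. card (T ((s + m - L + i) mod m)))" by simp
    also have "\<dots> \<le> load n h (bucket_arc m (s + m - L) L)"
      using L prev by (intro stored_le_load) simp_all
    finally show False using * L \<open>L \<noteq> 0\<close> by (auto simp: no_inflow_def dest!: spec[of _ L])
  qed
qed

text \<open>The last bucket has room, so no key hashed into the block is stored past it and the
  whole arc stays below capacity. Nothing flows in either, so each shorter initial arc is filled by
  keys hashed into it.\<close>

lemma block_imp_load_passage:
  assumes nf: "\<not> full b T ((s + m - 1) mod m)" and l: "1 \<le> l" "l \<le> m"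
    and f: "\<And>i. i < l - 1 \<Longrightarrow> full b T ((s + i) mod m)"
    and last: "\<not> full b T ((s + l - 1) mod m)"
  shows "load_passage b m n s h l"
  unfolding load_passage_def
proof (intro conjI allI impI l)
  have "load n h (bucket_arc m s l) \<le> (\<Sum>i<l. card (T ((s + i) mod m)))"
    using last l by (rule load_le_stored)
  also have "\<dots> < (\<Sum>i<l. b)"
  proof (rule sum_strict_mono_ex1)
    have "s + (l - 1) = s + l - 1" using l by simp
    then have "card (T ((s + (l - 1)) mod m)) < b" using last by (simp only: full_iff)
    then show "\<exists>a\<in>{..<l}. card (T ((s + a) mod m)) < b" using l by (intro bexI[of _ "l - 1"]) auto
  qed (simp_all add: card_bucket_le)
  finally show "load n h (bucket_arc m s l) < b * l" by (simp add: mult.commute)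
next
  fix i assume i: "1 \<le> i" "i < l"
  have "card (T ((s + j) mod m)) = b" if "j < i" for j
    using f[of j] that i by (simp add: full_def)
  then have "b * i = (\<Sum>j<i. card (T ((s + j) mod m)))" by simp
  also have "\<dots> \<le> load n h (bucket_arc m s i)" using nf i l by (intro stored_le_load) simp_all
  finally show "b * i \<le> load n h (bucket_arc m s i)" .
qed

lemma ex_block:
  assumes nf: "\<not> full b T ((s + m - 1) mod m)"
  obtains l where "1 \<le> l" "l \<le> m" "\<And>i. i < l - 1 \<Longrightarrow> full b T ((s + i) mod m)"
    "\<not> full b T ((s + l - 1) mod m)"
proof -
  define P where "P l \<longleftrightarrow> 1 \<le> l \<and> \<not> full b T ((s + l - 1) mod m)" for l
  have "1 \<le> m" using m_pos by linarith
  \<comment> \<open>One full turn leads back to the bucket preceding \<open>s\<close>, so the length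
    \<open>m\<close> is admissible.\<close>
  then have "P m" unfolding P_def using nf by blast
  define l where "l = (LEAST l. P l)"
  have Pl: "P l" unfolding l_def using \<open>P m\<close> by (rule LeastI)
  have "l \<le> m" unfolding l_def using \<open>P m\<close> by (rule Least_le)
  moreover have "full b T ((s + i) mod m)" if "i < l - 1" for i
  proof -
    have "\<not> P (Suc i)" using that unfolding l_def by (intro not_less_Least) simp
    then show ?thesis by (simp add: P_def)
  qed
  ultimately show ?thesis using Pl that by (auto simp: P_def)
qed

end

lemma load_passage_unique:
  assumes "load_passage b m n s h l" "load_passage b m n s h l'"
  shows "l = l'"
proof -
  have "\<not> i < j" if "load_passage b m n s h i" "load_passage b m n s h j" for i j
    using that unfolding load_passage_def by (meson leD)
  then show ?thesis using assms by (meson linorder_neqE_nat)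
qed

context probing begin

text \<open>For the direction from loads to blocks, a bucket without inflow starts some block; its
  length is a passage time, and passage times are unique.\<close>

lemma blocks_iff:
  "(s, l) \<in> blocks b m T \<longleftrightarrow> s < m \<and> no_inflow m b m n s h \<and> load_passage b m n s h l"
proof
  assume "(s, l) \<in> blocks b m T"
  then show "s < m \<and> no_inflow m b m n s h \<and> load_passage b m n s h l"
    using block_imp_load_passage nonfull_iff_no_inflow by (auto simp: blocks_def)
next
  assume *: "s < m \<and> no_inflow m b m n s h \<and> load_passage b m n s h l"
  then have nf: "\<not> full b T ((s + m - 1) mod m)" unfolding nonfull_iff_no_inflow by blast
  obtain l' where l': "1 \<le> l'" "l' \<le> m" "\<And>i. i < l' - 1 \<Longrightarrow> full b T ((s + i) mod m)"
    "\<not> full b T ((s + l' - 1) mod m)" using ex_block[OF nf] by blast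
  have "load_passage b m n s h l'" using block_imp_load_passage[OF nf l'] .
  then have "l' = l" using * load_passage_unique by blast
  then show "(s, l) \<in> blocks b m T" using l' nf * by (auto simp: blocks_def)
qed

lemma ex_load_passage:
  "no_inflow m b m n s h \<Longrightarrow> \<exists>l. load_passage b m n s h l"
  by (metis block_imp_load_passage ex_block nonfull_iff_no_inflow)

text \<open>At most \<open>n / b\<close> buckets are full, since each of them holds \<open>b\<close>
  keys. Each of the remaining buckets is followed by one without inflow. The bound is multiplied out
  to stay within the naturals.\<close>

lemma card_nonfull_ge: "b * m \<le> n + b * card {s\<in>{..<m}. no_inflow m b m n s h}"
proof -
  let ?f = "\<lambda>s. (m - 1 + s) mod m"
  have "card {s\<in>{..<m}. full b T (?f s)} \<le> card {s\<in>{..<m}. full b T s}"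
  proof (rule card_inj_on_le)
    show "inj_on ?f {s\<in>{..<m}. full b T (?f s)}"
      by (rule inj_on_subset[OF inj_on_bucket_arc[of m m "m - 1"]]) auto
  qed (use m_pos in auto)
  then have "b * card {s\<in>{..<m}. full b T (?f s)} \<le> b * card {s\<in>{..<m}. full b T s}"
    by simp
  also have "\<dots> = (\<Sum>s | s\<in>{..<m} \<and> full b T s. card (T s))"
    by (simp add: full_def)
  also have "\<dots> \<le> (\<Sum>s<m. card (T s))" by (rule sum_mono2) auto
  also have "\<dots> = n" using inv by (rule sum_card_table)
  finally have 1: "b * card {s\<in>{..<m}. full b T ((m - 1 + s) mod m)} \<le> n" by simp
  have "card {..<m} = card ({s\<in>{..<m}. full b T ((m - 1 + s) mod m)} \<union> {s\<in>{..<m}. no_inflow m b m n s h})"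
    by (rule arg_cong[where f = card]) (auto simp: nonfull_iff_no_inflow[symmetric] add.commute[of m])
  also have "\<dots> \<le> card {s\<in>{..<m}. full b T ((m - 1 + s) mod m)} + card {s\<in>{..<m}. no_inflow m b m n s h}"
    by (rule card_Un_le)
  finally have "b * m \<le> b * (card {s\<in>{..<m}. full b T ((m - 1 + s) mod m)} + card {s\<in>{..<m}. no_inflow m b m n s h})"
    by simp
  with 1 show ?thesis by (simp add: algebra_simps)
qed

end

section \<open>Uniformly random addresses\<close>

abbreviation addresses :: "nat \<Rightarrow> nat \<Rightarrow> (nat \<Rightarrow> nat) set" where
  "addresses m n \<equiv> {0..<n} \<rightarrow>\<^sub>E {0..<m}"

text \<open>A quotient of counts instead of a measure: invariance arguments become bijections
  between finite sets, and generating functions become finite sums.\<close>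

definition addr_prob :: "nat \<Rightarrow> nat \<Rightarrow> ((nat \<Rightarrow> nat) \<Rightarrow> bool) \<Rightarrow> real" where
  "addr_prob m n P = real (card {h \<in> addresses m n. P h}) / real m ^ n"

lemma finite_addresses [simp]: "finite (addresses m n)"
  by (rule finite_PiE) auto

lemma card_addresses [simp]: "card (addresses m n) = m ^ n"
  by (simp add: card_PiE)

lemma addr_prob_mono:
  assumes "\<And>h. h \<in> addresses m n \<Longrightarrow> P h \<Longrightarrow> Q h"
  shows "addr_prob m n P \<le> addr_prob m n Q"
  unfolding addr_prob_def using assms
  by (intro divide_right_mono of_nat_mono card_mono) auto

lemma addr_prob_cong:
  assumes "\<And>h. P h \<longleftrightarrow> Q h"
  shows "addr_prob m n P = addr_prob m n Q"
  using assms by presburger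

lemma addr_prob_disj: "addr_prob m n (\<lambda>h. P h \<or> Q h) \<le> addr_prob m n P + addr_prob m n Q"
proof -
  have "{h \<in> addresses m n. P h \<or> Q h} = {h \<in> addresses m n. P h} \<union> {h \<in> addresses m n. Q h}"
    by auto
  then have "card {h \<in> addresses m n. P h \<or> Q h}
      \<le> card {h \<in> addresses m n. P h} + card {h \<in> addresses m n. Q h}"
    by (simp add: card_Un_le)
  then have "real (card {h \<in> addresses m n. P h \<or> Q h})
      \<le> real (card {h \<in> addresses m n. P h}) + real (card {h \<in> addresses m n. Q h})"
    by linarith
  then show ?thesis
    unfolding addr_prob_def add_divide_distrib[symmetric] by (rule divide_right_mono) simp
qed

lemma addr_prob_Bex:
  assumes "finite I"
  shows "addr_prob m n (\<lambda>h. \<exists>i\<in>I. P i h) \<le> (\<Sum>i\<in>I. addr_prob m n (P i))"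
  using assms
proof (induction I rule: finite_induct)
  case (insert i I)
  have "addr_prob m n (\<lambda>h. \<exists>i\<in>insert i I. P i h) \<le> addr_prob m n (P i) + addr_prob m n (\<lambda>h. \<exists>i\<in>I. P i h)"
    using addr_prob_disj[of m n "P i" "\<lambda>h. \<exists>i\<in>I. P i h"] by simp
  with insert show ?case by simp
qed (simp add: addr_prob_def)

section \<open>Rotation invariance\<close>

definition rotate_addr :: "nat \<Rightarrow> nat \<Rightarrow> nat \<Rightarrow> (nat \<Rightarrow> nat) \<Rightarrow> nat \<Rightarrow> nat" where
  "rotate_addr m n s h = (\<lambda>k\<in>{0..<n}. (s + h k) mod m)"

lemma rotate_addr_image:
  assumes "0 < m"
  shows "inj_on (rotate_addr m n s) (addresses m n)"
    and "rotate_addr m n s ` addresses m n = addresses m n"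
proof -
  show inj: "inj_on (rotate_addr m n s) (addresses m n)"
  proof (rule inj_onI)
    fix h h' assume h: "h \<in> addresses m n" "h' \<in> addresses m n"
      and eq: "rotate_addr m n s h = rotate_addr m n s h'"
    show "h = h'"
    proof (rule PiE_ext[OF h])
      fix k assume k: "k \<in> {0..<n}"
      then have "(s + h k) mod m = (s + h' k) mod m"
        using fun_cong[OF eq, of k] by (simp add: rotate_addr_def)
      moreover have "h k < m" "h' k < m" using h k by (auto dest!: PiE_mem)
      ultimately show "h k = h' k" by (rule mod_add_right_inj)
    qed
  qed
  show "rotate_addr m n s ` addresses m n = addresses m n"
  proof (rule card_subset_eq)
    show "rotate_addr m n s ` addresses m n \<subseteq> addresses m n"
      using assms by (auto simp: rotate_addr_def)
  qed (simp_all only: card_image[OF inj] finite_addresses)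
qed

lemma load_rotate_addr:
  assumes h: "h \<in> addresses m n"
  shows "load n (rotate_addr m n s h) (bucket_arc m (s + a) j) = load n h (bucket_arc m a j)"
proof -
  have "(s + h k) mod m \<in> bucket_arc m (s + a) j \<longleftrightarrow> h k \<in> bucket_arc m a j" if "k < n" for k
  proof -
    have hk: "h k < m" using h that by (auto dest!: PiE_mem)
    have "(s + h k) mod m = (s + a + i) mod m \<longleftrightarrow> h k = (a + i) mod m" for i
    proof -
      have "(s + h k) mod m = (s + a + i) mod m \<longleftrightarrow> [s + h k = s + (a + i)] (mod m)"
        by (simp add: cong_def add.assoc)
      also have "\<dots> \<longleftrightarrow> [h k = a + i] (mod m)" by (rule cong_add_lcancel_nat)
      finally show ?thesis using hk by (simp add: cong_def)
    qed
    then show ?thesis by (auto simp: bucket_arc_def)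
  qed
  then show ?thesis unfolding load_def rotate_addr_def
    by (intro arg_cong[where f = card]) auto
qed

text \<open>\<open>P\<close> sees the addresses only through loads of arcs placed relative to
  \<open>s\<close>, so rotating all addresses by \<open>s\<close> carries one set bijectively onto
  the other.\<close>

lemma card_rotate:
  assumes "0 < m"
  shows "card {h \<in> addresses m n. P (\<lambda>a j. load n h (bucket_arc m (s + a) j))}
    = card {h \<in> addresses m n. P (\<lambda>a j. load n h (bucket_arc m a j))}"
proof -
  have "rotate_addr m n s ` {h \<in> addresses m n. P (\<lambda>a j. load n h (bucket_arc m a j))}
     = {h \<in> addresses m n. P (\<lambda>a j. load n h (bucket_arc m (s + a) j))}" (is "?r ` ?A = ?B")
  proof (intro subset_antisym subsetI)
    fix g assume "g \<in> ?r ` ?A"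
    then obtain h where h: "g = ?r h" "h \<in> addresses m n" "P (\<lambda>a j. load n h (bucket_arc m a j))"
      by blast
    have "g \<in> addresses m n" using h(1,2) rotate_addr_image(2)[OF assms, of n s] by blast
    moreover have "P (\<lambda>a j. load n g (bucket_arc m (s + a) j))"
      using h by (simp only: load_rotate_addr)
    ultimately show "g \<in> ?B" by blast
  next
    fix h assume "h \<in> ?B"
    then have h: "h \<in> addresses m n" "P (\<lambda>a j. load n h (bucket_arc m (s + a) j))" by auto
    obtain h' where h': "h' \<in> addresses m n" "h = ?r h'"
      using h(1) rotate_addr_image(2)[OF assms, of n s] by blast
    have "P (\<lambda>a j. load n h' (bucket_arc m a j))"
      using h(2) unfolding h'(2) load_rotate_addr[OF h'(1)] .
    then show "h \<in> ?r ` ?A" using h' by blast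
  qed
  then have "card ?B = card (?r ` ?A)" by simp
  also have "\<dots> = card ?A"
    by (rule card_image) (rule inj_on_subset[OF rotate_addr_image(1)[OF assms]], auto)
  finally show ?thesis .
qed

lemma card_block_start:
  assumes "0 < m"
  shows "card {h \<in> addresses m n. no_inflow m b m n s h \<and> load_passage b m n s h l}
    = card {h \<in> addresses m n. no_inflow m b m n 0 h \<and> load_passage b m n 0 h l}" (is ?A)
    and "card {h \<in> addresses m n. no_inflow m b m n s h}
    = card {h \<in> addresses m n. no_inflow m b m n 0 h}" (is ?B)
proof -
  \<comment> \<open>Both events as predicates of loads relative to \<open>s\<close>. The start
    \<open>s + m - j\<close> becomes \<open>s + (m - j)\<close>, which agrees because
    \<open>j \<le> m\<close>.\<close>
  let ?N = "\<lambda>L. \<forall>j. 1 \<le> j \<longrightarrow> j \<le> m \<longrightarrow> L (m - j) j < b * j"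
  let ?T = "\<lambda>L. 1 \<le> l \<and> l \<le> m \<and> L 0 l < b * l \<and> (\<forall>i. 1 \<le> i \<longrightarrow> i < l \<longrightarrow> b * i \<le> L 0 i)"
  have N: "no_inflow m b m n s h \<longleftrightarrow> ?N (\<lambda>a j. load n h (bucket_arc m (s + a) j))" for s h
    by (simp add: no_inflow_def cong: conj_cong imp_cong)
  have T: "load_passage b m n s h l \<longleftrightarrow> ?T (\<lambda>a j. load n h (bucket_arc m (s + a) j))" for s h
    by (simp add: load_passage_def)
  show ?A unfolding N T
    using card_rotate[OF assms, of n "\<lambda>L. ?N L \<and> ?T L" s] card_rotate[OF assms, of n "\<lambda>L. ?N L \<and> ?T L" 0]
    by simp
  show ?B unfolding N
    using card_rotate[OF assms, of n ?N s] card_rotate[OF assms, of n ?N 0] by simp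
qed

lemma probing_hash_table:
  assumes "n < b * m" "h \<in> addresses m n"
  shows "probing b m n h (hash_table b m h n)"
  using assms by unfold_locales (auto intro!: probe_inv_hash_table dest!: PiE_mem)

text \<open>Double counting of pairs of an address map and a start without inflow: each map has at
  least \<open>m - n / b\<close> such starts, and by rotation every start occurs equally often. This
  keeps the conditioning event away from probability 0 uniformly in \<open>m\<close>.\<close>

lemma no_inflow_prob_ge:
  assumes "n < b * m"
  shows "1 - real n / (real b * real m) \<le> addr_prob m n (no_inflow m b m n s)"
proof -
  have m: "0 < m" and b: "0 < b" using assms by (auto intro: gr0I)
  define D where "D = card {h \<in> addresses m n. no_inflow m b m n 0 h}"
  have "(\<Sum>h\<in>addresses m n. card {s\<in>{..<m}. no_inflow m b m n s h})
      = (\<Sum>h\<in>addresses m n. \<Sum>s<m. of_bool (no_inflow m b m n s h))"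
    by (intro sum.cong refl) (simp add: Int_def)
  also have "\<dots> = (\<Sum>s<m. \<Sum>h\<in>addresses m n. of_bool (no_inflow m b m n s h))"
    by (rule sum.swap)
  also have "\<dots> = (\<Sum>s<m. D)"
    unfolding D_def
  proof (rule sum.cong[OF refl])
    fix s
    show "(\<Sum>h\<in>addresses m n. of_bool (no_inflow m b m n s h))
        = card {h \<in> addresses m n. no_inflow m b m n 0 h}"
      using card_block_start(2)[OF m, of n b s] by (simp add: Int_def)
  qed
  finally have swap: "(\<Sum>h\<in>addresses m n. card {s\<in>{..<m}. no_inflow m b m n s h}) = m * D" by simp
  have "(\<Sum>h\<in>addresses m n. b * m) \<le> (\<Sum>h\<in>addresses m n. n + b * card {s\<in>{..<m}. no_inflow m b m n s h})"
    using probing.card_nonfull_ge[OF probing_hash_table[OF assms]] by (rule sum_mono)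
  then have "m ^ n * (b * m) \<le> m ^ n * n + b * (m * D)"
    unfolding sum.distrib sum_distrib_left[symmetric] swap by (simp add: mult_ac)
  then have "real (m ^ n * (b * m)) \<le> real (m ^ n * n + b * (m * D))" by (rule of_nat_mono)
  then have "real m ^ n * (real b * real m) - real m ^ n * real n \<le> real b * (real m * real D)" by simp
  then have "1 - real n / (real b * real m) \<le> real D / real m ^ n"
    using m b by (simp add: field_simps)
  then show ?thesis unfolding addr_prob_def D_def card_block_start(2)[OF m, of n b s] .
qed

lemma no_inflow_prob_pos:
  assumes "n < b * m"
  shows "0 < addr_prob m n (no_inflow m b m n s)"
proof -
  have "real n < real b * real m" using assms by (metis of_nat_less_iff of_nat_mult)
  then have "0 < 1 - real n / (real b * real m)" by (simp add: divide_simps)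
  then show ?thesis using no_inflow_prob_ge[OF assms, of s] by linarith
qed

lemma all_blocks_iff:
  assumes "n < b * m"
  shows "(h, s, l) \<in> all_blocks b m n \<longleftrightarrow>
    h \<in> addresses m n \<and> s < m \<and> no_inflow m b m n s h \<and> load_passage b m n s h l"
  using probing.blocks_iff[OF probing_hash_table[OF assms]] by (auto simp: all_blocks_def)

lemma finite_all_blocks: "finite (all_blocks b m n)"
proof -
  have "finite (blocks b m T)" for T
    by (rule finite_subset[of _ "{..<m} \<times> {..m}"]) (auto simp: blocks_def)
  then show ?thesis by (auto simp: all_blocks_def)
qed

text \<open>Choosing among all blocks of all tables means choosing an address map together with a
  start. By rotation each of the \<open>m\<close> starts contributes equally, so the factor
  \<open>m\<close> cancels and a conditional probability at one start remains. The start
  \<open>s\<close> is left free so that it can be placed conveniently later.\<close>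

lemma pmf_block_length:
  assumes "n < b * m"
  shows "pmf (block_length_pmf b m n) l =
    addr_prob m n (\<lambda>h. no_inflow m b m n s h \<and> load_passage b m n s h l)
    / addr_prob m n (no_inflow m b m n s)"
proof -
  have m: "0 < m" using assms by (auto intro: gr0I)
  define N where "N s = {h \<in> addresses m n. no_inflow m b m n s h \<and> load_passage b m n s h l}" for s
  define D where "D s = {h \<in> addresses m n. no_inflow m b m n s h}" for s
  have fin: "finite (N s)" "finite (D s)" for s by (simp_all add: N_def D_def)
  have cN: "card (N s') = card (N s)" for s'
    unfolding N_def using card_block_start(1)[OF m, of n b s' l] card_block_start(1)[OF m, of n b s l] by linarith
  have cD: "card (D s') = card (D s)" for s'
    unfolding D_def using card_block_start(2)[OF m, of n b s'] card_block_start(2)[OF m, of n b s] by linarith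
  have "all_blocks b m n \<inter> {(h, s, l'). l' = l} = (\<lambda>(s, h). (h, s, l)) ` (SIGMA s:{..<m}. N s)"
    using all_blocks_iff[OF assms] by (auto simp: N_def image_iff)
  then have "card (all_blocks b m n \<inter> {(h, s, l'). l' = l}) = card (SIGMA s:{..<m}. N s)"
    by (simp add: card_image inj_on_def)
  then have 1: "card (all_blocks b m n \<inter> {(h, s, l'). l' = l}) = m * card (N s)"
    using fin sum.cong[OF refl[of "{..<m}"] cN] by simp
  \<comment> \<open>Every start without inflow carries exactly one block, so forgetting the length
    loses nothing.\<close>
  have "(\<lambda>(h, s, l). (s, h)) ` all_blocks b m n = (SIGMA s:{..<m}. D s)"
  proof safe
    fix s' h assume h: "s' < m" "h \<in> D s'"
    then obtain l' where "load_passage b m n s' h l'"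
      using probing.ex_load_passage[OF probing_hash_table[OF assms]] unfolding D_def by blast
    then have "(h, s', l') \<in> all_blocks b m n" using h by (auto simp: all_blocks_iff[OF assms] D_def)
    then show "(s', h) \<in> (\<lambda>(h, s, l). (s, h)) ` all_blocks b m n" by force
  qed (auto simp: all_blocks_iff[OF assms] D_def)
  moreover have "inj_on (\<lambda>(h, s, l). (s, h)) (all_blocks b m n)"
    by (auto simp: inj_on_def all_blocks_iff[OF assms] dest: load_passage_unique)
  ultimately have "card (all_blocks b m n) = card (SIGMA s:{..<m}. D s)"
    using card_image by fastforce
  then have 2: "card (all_blocks b m n) = m * card (D s)"
    using fin sum.cong[OF refl[of "{..<m}"] cD] by simp
  have "0 < card (D s)" using no_inflow_prob_pos[OF assms, of s] fin(2)[of s]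
    by (auto simp: addr_prob_def D_def intro: gr0I)
  then have ne: "all_blocks b m n \<noteq> {}" using 2 m by auto
  have "pmf (block_length_pmf b m n) l
      = measure (measure_pmf (pmf_of_set (all_blocks b m n))) {(h, s, l'). l' = l}"
    unfolding block_length_pmf_def pmf_map
    by (rule arg_cong[where f = "measure _"]) auto
  also have "\<dots> = real (m * card (N s)) / real (m * card (D s))"
    by (simp add: measure_pmf_of_set[OF ne finite_all_blocks] 1 2)
  also have "\<dots> = addr_prob m n (\<lambda>h. no_inflow m b m n s h \<and> load_passage b m n s h l)
    / addr_prob m n (no_inflow m b m n s)"
    using m by (simp add: addr_prob_def N_def D_def)
  finally show ?thesis .
qed

section \<open>Chernoff bound for overloaded arcs\<close>

lemma sum_power_load:
  fixes z :: real
  assumes "A \<subseteq> {..<m}"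
  shows "(\<Sum>h\<in>addresses m n. z ^ load n h A) = (real m + real (card A) * (z - 1)) ^ n"
proof -
  have "z ^ load n h A = (\<Prod>k\<in>{0..<n}. if h k \<in> A then z else 1)" for h
  proof -
    have "(\<Prod>k\<in>{0..<n}. if h k \<in> A then z else 1) = (\<Prod>k\<in>{k\<in>{0..<n}. h k \<in> A}. z)"
      by (rule prod.inter_filter[symmetric]) simp
    also have "\<dots> = z ^ load n h A" by (simp add: load_def)
    finally show ?thesis by simp
  qed
  then have "(\<Sum>h\<in>addresses m n. z ^ load n h A)
      = (\<Sum>h\<in>addresses m n. \<Prod>k\<in>{0..<n}. if h k \<in> A then z else 1)" by simp
  also have "\<dots> = (\<Prod>k\<in>{0..<n}. \<Sum>a\<in>{0..<m}. if a \<in> A then z else 1)"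
    by (subst prod_sum_PiE) auto
  also have "(\<Sum>a\<in>{0..<m}. if a \<in> A then z else 1) = (\<Sum>a\<in>{0..<m}. 1 + (if a \<in> A then z - 1 else 0))"
    by (rule sum.cong) auto
  also have "\<dots> = real m + (\<Sum>a\<in>{a\<in>{0..<m}. a \<in> A}. z - 1)"
    by (subst sum.inter_filter) (auto simp: sum.distrib)
  also have "{a\<in>{0..<m}. a \<in> A} = A" using assms by auto
  finally show ?thesis by simp
qed

text \<open>Markov's inequality for \<open>z ^ load n h A\<close>, whose sum over all address maps
  factors over the keys, followed by \<open>1 + x \<le> exp x\<close>.\<close>

lemma addr_prob_chernoff:
  fixes z :: real
  assumes "A \<subseteq> {..<m}" "1 \<le> z" "0 < m"
  shows "addr_prob m n (\<lambda>h. t \<le> load n h A) \<le> exp (real (card A) * (z - 1) * real n / real m) / z ^ t"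
proof -
  let ?B = "{h \<in> addresses m n. t \<le> load n h A}"
  have "real (card ?B) * z ^ t = (\<Sum>h\<in>?B. z ^ t)" by simp
  also have "\<dots> \<le> (\<Sum>h\<in>?B. z ^ load n h A)" using assms by (intro sum_mono power_increasing) auto
  also have "\<dots> \<le> (\<Sum>h\<in>addresses m n. z ^ load n h A)" using assms by (intro sum_mono2) auto
  also have "\<dots> = (real m + real (card A) * (z - 1)) ^ n" using assms by (simp add: sum_power_load)
  also have "\<dots> = real m ^ n * (1 + real (card A) * (z - 1) / real m) ^ n"
    using assms by (simp add: power_mult_distrib[symmetric] distrib_left)
  also have "\<dots> \<le> real m ^ n * exp (real (card A) * (z - 1) / real m) ^ n"
    using assms by (intro mult_left_mono power_mono exp_ge_add_one_self) auto
  also have "exp (real (card A) * (z - 1) / real m) ^ n = exp (real (card A) * (z - 1) * real n / real m)"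
    by (simp add: exp_of_nat_mult[symmetric] algebra_simps)
  finally show ?thesis using assms by (simp add: addr_prob_def field_simps)
qed

text \<open>The optimal Chernoff factor per bucket when \<open>\<beta>\<close> bounds the load
  factor \<open>n / (b m)\<close>: the minimum over \<open>z\<close> of
  \<open>exp (\<beta> b (z - 1)) / z ^ b\<close>, attained at
  \<open>z = 1 / \<beta>\<close>.\<close>

definition overload_rate :: "real \<Rightarrow> nat \<Rightarrow> real" where
  "overload_rate \<beta> b = (\<beta> * exp (1 - \<beta>)) ^ b"

lemma overload_rate_pos: "0 < \<beta> \<Longrightarrow> 0 < overload_rate \<beta> b"
  by (simp add: overload_rate_def)

lemma overload_rate_less_1:
  assumes "0 < \<beta>" "\<beta> < 1" "1 \<le> b"
  shows "overload_rate \<beta> b < 1"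
proof -
  have "ln \<beta> < \<beta> - 1"
    using ln_le_minus_one[of \<beta>] ln_eq_minus_one[of \<beta>] assms by fastforce
  then have "exp (ln \<beta> + (1 - \<beta>)) < exp 0" by (subst exp_less_cancel_iff) simp
  then have "\<beta> * exp (1 - \<beta>) < 1" using assms by (simp add: exp_add)
  then show ?thesis unfolding overload_rate_def using assms by (intro power_less_one_iff[THEN iffD2]) auto
qed

text \<open>The bound is geometric in \<open>j\<close> with a rate free of \<open>m\<close>. This
  uniformity serves both the truncation of the inflow condition and the domination of the block
  length.\<close>

lemma addr_prob_overload:
  assumes "0 < \<beta>" "\<beta> < 1" "0 < m" "j \<le> m" "real n \<le> \<beta> * (real b * real m)"
  shows "addr_prob m n (\<lambda>h. b * j \<le> load n h (bucket_arc m s j)) \<le> overload_rate \<beta> b ^ j"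
proof -
  have "addr_prob m n (\<lambda>h. b * j \<le> load n h (bucket_arc m s j))
      \<le> exp (real j * (1 / \<beta> - 1) * real n / real m) / (1 / \<beta>) ^ (b * j)"
    using addr_prob_chernoff[OF bucket_arc_subset[OF assms(3), of s j], of "1 / \<beta>" n "b * j"] assms
    by (simp add: card_bucket_arc)
  also have "\<dots> \<le> exp (real (b * j) * (1 - \<beta>)) / (1 / \<beta>) ^ (b * j)"
  proof -
    have "real n / real m \<le> \<beta> * real b" using assms by (simp add: field_simps)
    then have "real j * (1 / \<beta> - 1) * (real n / real m) \<le> real j * (1 / \<beta> - 1) * (\<beta> * real b)"
      using assms by (intro mult_left_mono) auto
    also have "\<dots> = real (b * j) * (1 - \<beta>)" using assms by (simp add: field_simps)
    finally show ?thesis using assms by (intro divide_right_mono) auto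
  qed
  also have "\<dots> = overload_rate \<beta> b ^ j"
    unfolding overload_rate_def exp_of_nat_mult
    by (simp add: power_mult[symmetric] power_mult_distrib power_one_over field_simps)
  finally show ?thesis .
qed

section \<open>Poisson limit of the bucket loads\<close>

text \<open>The multinomial count, by peeling off one value \<open>a\<close> at a time: choose its
  fibre \<open>S\<close>, then map the other keys into \<open>V - {a}\<close>. The map
  \<open>glue\<close> reassembles the two pieces. Denominators are multiplied out so that the
  identity lives in the naturals.\<close>

lemma card_prescribed_fibres:
  assumes "finite W" "finite K" "finite V" "W \<subseteq> V" "sum x W \<le> card K"
  shows "card {h \<in> K \<rightarrow>\<^sub>E V. \<forall>a\<in>W. card {k \<in> K. h k = a} = x a}
      * (\<Prod>a\<in>W. fact (x a)) * fact (card K - sum x W)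
    = fact (card K) * (card V - card W) ^ (card K - sum x W)"
  using assms
proof (induction W arbitrary: K V rule: finite_induct)
  case empty
  then show ?case by (simp add: card_PiE)
next
  case (insert a W)
  define F where "F = {h \<in> K \<rightarrow>\<^sub>E V. \<forall>c\<in>insert a W. card {k \<in> K. h k = c} = x c}"
  define A where "A S = {g \<in> (K - S) \<rightarrow>\<^sub>E (V - {a}). \<forall>c\<in>W. card {k \<in> K - S. g k = c} = x c}" for S
  define SS where "SS = {S. S \<subseteq> K \<and> card S = x a}"
  define glue where "glue = (\<lambda>(S, g :: 'b \<Rightarrow> 'a) k. if k \<in> S then a else g k)"
  have finSS: "finite SS" unfolding SS_def using insert.prems(1) by simp
  have finA: "finite (A S)" for S
    unfolding A_def
  proof (rule finite_subset)
    show "finite ((K - S) \<rightarrow>\<^sub>E (V - {a}))"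
      using insert.prems(1,2) by (simp add: finite_PiE)
  qed blast
  have fibre_a: "{k \<in> K. glue (S, g) k = a} = S" if "S \<in> SS" "g \<in> A S" for S g
    using that by (auto simp: SS_def A_def glue_def PiE_iff)
  have fibre: "{k \<in> K. glue (S, g) k = c} = {k \<in> K - S. g k = c}"
    if "S \<in> SS" "g \<in> A S" "c \<in> W" for S g c
    using that insert.hyps by (auto simp: SS_def A_def glue_def PiE_iff)
  have inj: "inj_on glue (Sigma SS A)"
  proof (rule inj_onI, clarify)
    fix S g S' g'
    assume *: "S \<in> SS" "g \<in> A S" "S' \<in> SS" "g' \<in> A S'" "glue (S, g) = glue (S', g')"
    have S: "S = S'" using fibre_a[OF *(1,2)] fibre_a[OF *(3,4)] *(5) by simp
    have "g = g'"
    proof (rule PiE_ext)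
      show "g \<in> (K - S) \<rightarrow>\<^sub>E (V - {a})" "g' \<in> (K - S) \<rightarrow>\<^sub>E (V - {a})"
        using * S by (auto simp: A_def)
      show "g k = g' k" if "k \<in> K - S" for k
        using fun_cong[OF *(5), of k] that S by (simp add: glue_def)
    qed
    with S show "S = S' \<and> g = g'" by simp
  qed
  have "glue ` Sigma SS A = F"
  proof (intro subset_antisym subsetI)
    fix h assume "h \<in> glue ` Sigma SS A"
    then obtain S g where h: "h = glue (S, g)" "S \<in> SS" "g \<in> A S" by auto
    have "h \<in> K \<rightarrow>\<^sub>E V"
    proof (rule PiE_I)
      show "h k \<in> V" if "k \<in> K" for k
        using h that insert.prems by (auto simp: glue_def A_def PiE_iff)
      show "h k = undefined" if "k \<notin> K" for k
        using h that by (auto simp: glue_def A_def SS_def PiE_iff extensional_def)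
    qed
    moreover have "card {k \<in> K. h k = a} = x a"
      using fibre_a[OF h(2,3)] h by (simp add: SS_def)
    moreover have "card {k \<in> K. h k = c} = x c" if "c \<in> W" for c
      using fibre[OF h(2,3) that] h that by (simp add: A_def)
    ultimately show "h \<in> F" by (simp add: F_def)
  next
    fix h assume h: "h \<in> F"
    define S where "S = {k \<in> K. h k = a}"
    define g where "g = restrict h (K - S)"
    have hPi: "h \<in> K \<rightarrow>\<^sub>E V" and hc: "\<And>c. c \<in> insert a W \<Longrightarrow> card {k \<in> K. h k = c} = x c"
      using h by (auto simp: F_def)
    have S: "S \<in> SS" using hc[of a] by (auto simp: SS_def S_def)
    have "{k \<in> K - S. g k = c} = {k \<in> K. h k = c}" if "c \<in> W" for c
      using that insert.hyps by (auto simp: g_def S_def)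
    then have "g \<in> A S" using hPi hc by (auto simp: A_def g_def S_def PiE_iff)
    moreover have "h = glue (S, g)"
      using hPi by (auto simp: glue_def g_def S_def PiE_iff extensional_def)
    ultimately show "h \<in> glue ` Sigma SS A" using S by blast
  qed
  then have "card F = card (Sigma SS A)" using card_image[OF inj] by simp
  also have "\<dots> = (\<Sum>S\<in>SS. card (A S))" using finSS finA by simp
  finally have cF: "card F = (\<Sum>S\<in>SS. card (A S))" .
  define N where "N = card K - sum x (insert a W)"
  have sumx: "sum x (insert a W) = x a + sum x W" using insert.hyps by simp
  have IH: "card (A S) * (\<Prod>c\<in>W. fact (x c)) * fact N
      = fact (card K - x a) * (card V - card (insert a W)) ^ N" if "S \<in> SS" for S
  proof -
    have S: "S \<subseteq> K" "card S = x a" using that by (auto simp: SS_def)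
    then have cK: "card (K - S) = card K - x a"
      using insert.prems(1) by (simp add: card_Diff_subset finite_subset)
    have cV: "card (V - {a}) - card W = card V - card (insert a W)"
      using insert.prems insert.hyps by simp
    have N: "card K - x a - sum x W = N" unfolding N_def sumx by simp
    have "finite (K - S)" "finite (V - {a})" "W \<subseteq> V - {a}" "sum x W \<le> card (K - S)"
      using insert.prems insert.hyps sumx cK by auto
    from insert.IH[OF this] show ?thesis unfolding A_def[symmetric] cK cV N .
  qed
  have "card F * (\<Prod>c\<in>insert a W. fact (x c)) * fact N
      = fact (x a) * (\<Sum>S\<in>SS. card (A S) * (\<Prod>c\<in>W. fact (x c)) * fact N)"
    unfolding cF sum_distrib_right[symmetric] using insert.hyps by (simp add: mult_ac)
  also have "\<dots> = fact (x a) * (card SS * (fact (card K - x a) * (card V - card (insert a W)) ^ N))"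
    using IH by simp
  also have "card SS = card K choose x a"
    unfolding SS_def using insert.prems(1) by (rule n_subsets)
  also have "fact (x a) * ((card K choose x a) * (fact (card K - x a) * (card V - card (insert a W)) ^ N))
     = (fact (x a) * fact (card K - x a) * (card K choose x a)) * (card V - card (insert a W)) ^ N"
    by (simp add: mult_ac)
  also have "fact (x a) * fact (card K - x a) * (card K choose x a) = fact (card K)"
    using insert.prems(4) sumx by (intro binomial_fact_lemma) simp
  finally show ?case by (simp add: F_def N_def)
qed

text \<open>The quotient of factorials is a product of \<open>s\<close> factors; each induction step
  adds one factor \<open>(n - s) / m\<close>, which tends to \<open>r\<close>.\<close>

lemma falling_factorial_tendsto:
  fixes m n :: "nat \<Rightarrow> nat"
  assumes m: "filterlim m at_top sequentially" and n: "filterlim n at_top sequentially"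
    and r: "(\<lambda>k. real (n k) / real (m k)) \<longlonglongrightarrow> r"
  shows "(\<lambda>k. fact (n k) / (fact (n k - s) * real (m k) ^ s)) \<longlonglongrightarrow> r ^ s"
proof (induction s)
  case 0
  then show ?case by simp
next
  case (Suc s)
  have m': "filterlim (\<lambda>k. real (m k)) at_top sequentially"
    using filterlim_compose[OF filterlim_real_sequentially m] .
  have "(\<lambda>k. real (n k) / real (m k) - real s / real (m k)) \<longlonglongrightarrow> r - 0"
    by (intro tendsto_diff r tendsto_divide_0[OF tendsto_const] filterlim_at_top_imp_at_infinity m')
  then have "(\<lambda>k. fact (n k) / (fact (n k - s) * real (m k) ^ s)
      * (real (n k) / real (m k) - real s / real (m k))) \<longlonglongrightarrow> r ^ s * (r - 0)"
    by (intro tendsto_mult Suc)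
  moreover have "eventually (\<lambda>k. fact (n k) / (fact (n k - s) * real (m k) ^ s)
      * (real (n k) / real (m k) - real s / real (m k))
      = fact (n k) / (fact (n k - Suc s) * real (m k) ^ Suc s)) sequentially"
    using filterlim_at_top[THEN iffD1, OF n, rule_format, of "Suc s"]
      filterlim_at_top[THEN iffD1, OF m, rule_format, of 1]
  proof eventually_elim
    case (elim k)
    have d: "n k - s = Suc (n k - Suc s)" using elim by simp
    have f: "(fact (n k - s) :: real) = real (n k - s) * fact (n k - Suc s)" by (simp add: d)
    have "real (n k) / real (m k) - real s / real (m k) = real (n k - s) / real (m k)"
      using elim by (simp add: diff_divide_distrib of_nat_diff)
    then show ?case unfolding f using elim by (simp add: divide_simps)
  qed
  ultimately show ?case by (auto simp: mult.commute elim: Lim_transform_eventually)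
qed

text \<open>Write the power as \<open>(1 - w / m) ^ m\<close> raised to the real exponent
  \<open>(n - s) / m\<close>: the base tends to \<open>exp (- w)\<close> and the exponent to
  \<open>r\<close>. The rewriting needs a positive base, hence \<open>m > w\<close>, and
  \<open>n \<ge> s\<close>.\<close>

lemma shrink_power_tendsto:
  fixes m n :: "nat \<Rightarrow> nat"
  assumes m: "filterlim m at_top sequentially" and n: "filterlim n at_top sequentially"
    and r: "(\<lambda>k. real (n k) / real (m k)) \<longlonglongrightarrow> r"
  shows "(\<lambda>k. (1 - real w / real (m k)) ^ (n k - s)) \<longlonglongrightarrow> exp (- r) ^ w"
proof -
  have m': "filterlim (\<lambda>k. real (m k)) at_top sequentially"
    using filterlim_compose[OF filterlim_real_sequentially m] .
  have c0: "(\<lambda>k. c / real (m k)) \<longlonglongrightarrow> 0" for c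
    by (intro tendsto_divide_0[OF tendsto_const] filterlim_at_top_imp_at_infinity m')
  have 1: "(\<lambda>k. (1 + (- real w) / real (m k)) ^ m k) \<longlonglongrightarrow> exp (- real w)"
    using filterlim_compose[OF tendsto_exp_limit_sequentially m] .
  have "(\<lambda>k. real (n k) / real (m k) - real s / real (m k)) \<longlonglongrightarrow> r - 0"
    by (intro tendsto_diff r c0)
  then have "(\<lambda>k. ((1 + (- real w) / real (m k)) ^ m k) powr (real (n k) / real (m k) - real s / real (m k)))
      \<longlonglongrightarrow> exp (- real w) powr (r - 0)"
    by (intro tendsto_powr 1) auto
  moreover have "exp (- real w) powr (r - 0) = exp (- r) ^ w"
    by (simp add: powr_def exp_of_nat_mult[symmetric] mult.commute)
  moreover have "eventually (\<lambda>k. ((1 + (- real w) / real (m k)) ^ m k) powr (real (n k) / real (m k) - real s / real (m k))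
      = (1 - real w / real (m k)) ^ (n k - s)) sequentially"
    using filterlim_at_top[THEN iffD1, OF n, rule_format, of s]
      filterlim_at_top[THEN iffD1, OF m, rule_format, of "Suc w"]
  proof eventually_elim
    case (elim k)
    have pos: "0 < 1 - real w / real (m k)" using elim by (simp add: field_simps)
    have "real (m k) * (real (n k) / real (m k) - real s / real (m k)) = real (n k - s)"
      using elim by (simp add: field_simps)
    then show ?case using pos
      by (simp add: powr_realpow[symmetric] powr_powr)
  qed
  ultimately show ?thesis by (auto elim: Lim_transform_eventually)
qed

section \<open>Joint law of the loads of the first buckets\<close>

definition poisson_weight :: "real \<Rightarrow> nat list \<Rightarrow> real" where
  "poisson_weight r xs = (\<Prod>x\<leftarrow>xs. r ^ x / fact x * exp (- r))"

definition bucket_loads :: "nat \<Rightarrow> (nat \<Rightarrow> nat) \<Rightarrow> nat \<Rightarrow> nat \<Rightarrow> nat list" where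
  "bucket_loads n h i j = map (\<lambda>a. load n h {a}) [i..<j]"

lemma poisson_weight_nth:
  "poisson_weight r xs = r ^ sum_list xs * exp (- r) ^ length xs / (\<Prod>i<length xs. fact (xs ! i))"
proof -
  have "poisson_weight r xs = (\<Prod>i<length xs. r ^ (xs ! i) / fact (xs ! i) * exp (- r))"
    unfolding poisson_weight_def prod.list_conv_set_nth by (simp add: atLeast0LessThan)
  also have "\<dots> = (\<Prod>i<length xs. r ^ (xs ! i)) * exp (- r) ^ length xs / (\<Prod>i<length xs. fact (xs ! i))"
    by (simp add: prod.distrib prod_dividef)
  also have "(\<Prod>i<length xs. r ^ (xs ! i)) = r ^ sum_list xs"
    by (simp add: power_sum[symmetric] sum_list_sum_nth atLeast0LessThan)
  finally show ?thesis .
qed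

text \<open>The multinomial law, with the factors grouped to match
  \<open>falling_factorial_tendsto\<close> and \<open>shrink_power_tendsto\<close>.\<close>

lemma addr_prob_bucket_loads:
  assumes "length xs \<le> m" "0 < m" "sum_list xs \<le> n"
  shows "addr_prob m n (\<lambda>h. bucket_loads n h 0 (length xs) = xs)
    = fact n / (fact (n - sum_list xs) * real m ^ sum_list xs)
      * (1 - real (length xs) / real m) ^ (n - sum_list xs) / (\<Prod>i<length xs. fact (xs ! i))"
proof -
  let ?w = "length xs" and ?s = "sum_list xs"
  have s: "(\<Sum>i<?w. xs ! i) = ?s" by (simp add: sum_list_sum_nth atLeast0LessThan)
  have "(bucket_loads n h 0 ?w = xs) \<longleftrightarrow> (\<forall>a\<in>{..<?w}. card {k \<in> {0..<n}. h k = a} = xs ! a)" for h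
  proof -
    have "{k. k < n \<and> h k \<in> {a}} = {k \<in> {0..<n}. h k = a}" for a by auto
    then have "load n h {a} = card {k \<in> {0..<n}. h k = a}" for a by (simp only: load_def)
    then have "bucket_loads n h 0 ?w ! a = card {k \<in> {0..<n}. h k = a}" if "a < ?w" for a
      using that by (simp add: bucket_loads_def)
    moreover have "length (bucket_loads n h 0 ?w) = ?w" by (simp add: bucket_loads_def)
    ultimately show ?thesis unfolding list_eq_iff_nth_eq by (metis lessThan_iff)
  qed
  then have "{h \<in> addresses m n. bucket_loads n h 0 ?w = xs}
     = {h \<in> addresses m n. \<forall>a\<in>{..<?w}. card {k \<in> {0..<n}. h k = a} = xs ! a}" by simp
  then have "card {h \<in> addresses m n. bucket_loads n h 0 ?w = xs} * (\<Prod>i<?w. fact (xs ! i)) * fact (n - ?s)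
      = fact n * (m - ?w) ^ (n - ?s)" (is "?c * ?p * _ = _")
    using card_prescribed_fibres[of "{..<?w}" "{0..<n}" "{0..<m}" "\<lambda>i. xs ! i"] assms
    by (simp add: s atLeast0LessThan lessThan_subset_iff)
  then have "real (?c * ?p * fact (n - ?s)) = real (fact n * (m - ?w) ^ (n - ?s))" by (rule arg_cong)
  then have e: "real ?c * (\<Prod>i<?w. fact (xs ! i)) * fact (n - ?s) = fact n * (real m - real ?w) ^ (n - ?s)"
    using assms by (simp add: of_nat_diff)
  have "real m - real ?w = real m * (1 - real ?w / real m)" using assms by (simp add: field_simps)
  then have "(real m - real ?w) ^ (n - ?s) = real m ^ (n - ?s) * (1 - real ?w / real m) ^ (n - ?s)"
    by (simp add: power_mult_distrib)
  moreover have "real m ^ n = real m ^ ?s * real m ^ (n - ?s)"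
    using assms by (simp add: power_add[symmetric])
  moreover have "(\<Prod>i<?w. fact (xs ! i)) > (0::real)" by (intro prod_pos) simp
  ultimately show ?thesis using e assms
    unfolding addr_prob_def by (simp add: field_simps)
qed

text \<open>Poisson approximation of the multinomial law for each single list; finiteness of
  \<open>X\<close> then lets the limit pass through the sum.\<close>

lemma addr_prob_bucket_loads_tendsto:
  fixes m n :: "nat \<Rightarrow> nat"
  assumes m: "filterlim m at_top sequentially" and n: "filterlim n at_top sequentially"
    and r: "(\<lambda>k. real (n k) / real (m k)) \<longlonglongrightarrow> r"
    and X: "finite X" "\<And>xs. xs \<in> X \<Longrightarrow> length xs = w"
  shows "(\<lambda>k. addr_prob (m k) (n k) (\<lambda>h. bucket_loads (n k) h 0 w \<in> X))
    \<longlonglongrightarrow> (\<Sum>xs\<in>X. poisson_weight r xs)"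
proof -
  have "(\<lambda>k. addr_prob (m k) (n k) (\<lambda>h. bucket_loads (n k) h 0 (length xs) = xs))
      \<longlonglongrightarrow> poisson_weight r xs" for xs
  proof -
    have "(\<lambda>k. fact (n k) / (fact (n k - sum_list xs) * real (m k) ^ sum_list xs)
      * (1 - real (length xs) / real (m k)) ^ (n k - sum_list xs) / (\<Prod>i<length xs. fact (xs ! i)))
      \<longlonglongrightarrow> r ^ sum_list xs * exp (- r) ^ length xs / (\<Prod>i<length xs. fact (xs ! i))"
      by (intro tendsto_divide tendsto_mult falling_factorial_tendsto shrink_power_tendsto assms tendsto_const)
        (simp add: prod_zero_iff)
    moreover have "eventually (\<lambda>k. fact (n k) / (fact (n k - sum_list xs) * real (m k) ^ sum_list xs)
      * (1 - real (length xs) / real (m k)) ^ (n k - sum_list xs) / (\<Prod>i<length xs. fact (xs ! i))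
      = addr_prob (m k) (n k) (\<lambda>h. bucket_loads (n k) h 0 (length xs) = xs)) sequentially"
      using filterlim_at_top[THEN iffD1, OF n, rule_format, of "sum_list xs"]
        filterlim_at_top[THEN iffD1, OF m, rule_format, of "Suc (length xs)"]
      by eventually_elim (rule addr_prob_bucket_loads[symmetric], auto)
    ultimately show ?thesis unfolding poisson_weight_nth by (rule Lim_transform_eventually)
  qed
  then have "(\<lambda>k. \<Sum>xs\<in>X. addr_prob (m k) (n k) (\<lambda>h. bucket_loads (n k) h 0 (length xs) = xs))
    \<longlonglongrightarrow> (\<Sum>xs\<in>X. poisson_weight r xs)" by (rule tendsto_sum)
  moreover have "(\<Sum>xs\<in>X. addr_prob m n (\<lambda>h. bucket_loads n h 0 (length xs) = xs))
      = addr_prob m n (\<lambda>h. bucket_loads n h 0 w \<in> X)" for m n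
  proof -
    have "{h \<in> addresses m n. bucket_loads n h 0 w \<in> X}
        = (\<Union>xs\<in>X. {h \<in> addresses m n. bucket_loads n h 0 w = xs})" by auto
    then have "card {h \<in> addresses m n. bucket_loads n h 0 w \<in> X}
        = (\<Sum>xs\<in>X. card {h \<in> addresses m n. bucket_loads n h 0 w = xs})"
      using X(1) by (simp only:) (rule card_UN_disjoint, auto)
    then show ?thesis
      unfolding addr_prob_def by (simp add: sum_divide_distrib X(2) cong: sum.cong)
  qed
  ultimately show ?thesis by simp
qed

lemma load_interval: "load n h {i..<j} = sum_list (bucket_loads n h i j)"
proof -
  have "{k. k < n \<and> h k \<in> {i..<j}} = (\<Union>a\<in>{i..<j}. {k. k < n \<and> h k \<in> {a}})" by auto
  then have "load n h {i..<j} = (\<Sum>a\<in>{i..<j}. load n h {a})"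
    unfolding load_def by (simp only:) (rule card_UN_disjoint, auto)
  then show ?thesis by (simp add: bucket_loads_def sum_list_distinct_conv_sum_set)
qed

lemma bucket_arc_interval: "i + j \<le> m \<Longrightarrow> bucket_arc m i j = {i..<i + j}"
proof -
  assume "i + j \<le> m"
  then have "bucket_arc m i j = (\<lambda>x. i + x) ` {0..<j}"
    unfolding bucket_arc_def by (intro image_cong) auto
  then show ?thesis by (simp add: image_add_atLeastLessThan add.commute)
qed

lemma bucket_loads_append:
  "i \<le> j \<Longrightarrow> j \<le> k \<Longrightarrow> bucket_loads n h i k = bucket_loads n h i j @ bucket_loads n h j k"
  using upt_add_eq_append[of i j "k - j"] by (simp add: bucket_loads_def)

lemma length_bucket_loads [simp]: "length (bucket_loads n h i j) = j - i"
  by (simp add: bucket_loads_def)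

section \<open>Inflow and passage events as finite sets of load lists\<close>

definition no_inflow_lists :: "nat \<Rightarrow> nat \<Rightarrow> nat list set" where
  "no_inflow_lists b J = {xs. length xs = J \<and>
     (\<forall>j. 1 \<le> j \<longrightarrow> j \<le> J \<longrightarrow> sum_list (drop (J - j) xs) < b * j)}"

definition passage_lists :: "nat \<Rightarrow> nat \<Rightarrow> nat list set" where
  "passage_lists b l = {xs. length xs = l \<and> 1 \<le> l \<and> sum_list xs < b * l \<and>
     (\<forall>i. 1 \<le> i \<longrightarrow> i < l \<longrightarrow> b * i \<le> sum_list (take i xs))}"

lemma finite_bounded_sum_lists: "finite {xs :: nat list. length xs = l \<and> sum_list xs \<le> c}"
proof (rule finite_subset)
  show "{xs :: nat list. length xs = l \<and> sum_list xs \<le> c} \<subseteq> {xs. set xs \<subseteq> {..c} \<and> length xs = l}"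
    using member_le_sum_list by fastforce
qed (simp add: finite_lists_length_eq)

lemma finite_no_inflow_lists: "finite (no_inflow_lists b J)"
proof (rule finite_subset[OF _ finite_bounded_sum_lists[of J "b * J"]])
  show "no_inflow_lists b J \<subseteq> {xs. length xs = J \<and> sum_list xs \<le> b * J}"
    \<comment> \<open>The condition with \<open>j = J\<close> bounds the whole sum; for
      \<open>J = 0\<close> only the empty list remains.\<close>
    by (cases J) (auto simp: no_inflow_lists_def dest!: spec[of _ J])
qed

lemma finite_passage_lists: "finite (passage_lists b l)"
  by (rule finite_subset[OF _ finite_bounded_sum_lists[of l "b * l"]]) (auto simp: passage_lists_def)

text \<open>Placing the start at \<open>J\<close> makes the \<open>J\<close> preceding buckets
  \<open>0, ..., J - 1\<close>, so the arcs of the truncated condition are intervals without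
  wrap-around.\<close>

lemma no_inflow_iff_lists:
  assumes "J \<le> m"
  shows "no_inflow J b m n J h \<longleftrightarrow> bucket_loads n h 0 J \<in> no_inflow_lists b J"
proof -
  have "load n h (bucket_arc m (J + m - j) j) = sum_list (drop (J - j) (bucket_loads n h 0 J))"
    if "j \<le> J" for j
  proof -
    have "J + m - j = (J - j) + m" using that by simp
    then have "bucket_arc m (J + m - j) j = bucket_arc m (J - j) j"
      using bucket_arc_mod[of m "J - j + m" j] bucket_arc_mod[of m "J - j" j] by simp
    also have "\<dots> = {J - j..<J}" using that assms by (subst bucket_arc_interval) auto
    finally show ?thesis
      using that bucket_loads_append[of 0 "J - j" J n h] by (simp add: load_interval)
  qed
  then show ?thesis by (auto simp: no_inflow_def no_inflow_lists_def)
qed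

lemma load_passage_iff_lists:
  assumes "s + l \<le> m"
  shows "load_passage b m n s h l \<longleftrightarrow> bucket_loads n h s (s + l) \<in> passage_lists b l"
proof -
  have "load n h (bucket_arc m s i) = sum_list (take i (bucket_loads n h s (s + l)))"
    if "i \<le> l" for i
    using that assms bucket_loads_append[of s "s + i" "s + l" n h]
    by (simp add: load_interval bucket_arc_interval)
  then show ?thesis using assms by (auto simp: load_passage_def passage_lists_def)
qed

text \<open>The probability that the Poisson passage time equals \<open>l\<close>. That these
  weights sum to 1 is not computed from this formula; it comes out of the limit of the block-length
  laws.\<close>

definition passage_weight :: "nat \<Rightarrow> real \<Rightarrow> nat \<Rightarrow> real" where
  "passage_weight b r l = (\<Sum>xs\<in>passage_lists b l. poisson_weight r xs)"

text \<open>The truncated condition reads buckets \<open>0, ..., J - 1\<close> and the passage event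
  reads the next \<open>l\<close>. Poisson weights multiply under concatenation, so the joint limit
  factors.\<close>

lemma truncated_no_inflow_tendsto:
  fixes m n :: "nat \<Rightarrow> nat" and b J l :: nat and r :: real
  assumes m: "filterlim m at_top sequentially" and n: "filterlim n at_top sequentially"
    and r: "(\<lambda>k. real (n k) / real (m k)) \<longlonglongrightarrow> r"
  defines "a \<equiv> \<Sum>xs\<in>no_inflow_lists b J. poisson_weight r xs"
  shows "(\<lambda>k. addr_prob (m k) (n k) (no_inflow J b (m k) (n k) J)) \<longlonglongrightarrow> a" (is ?A)
    and "(\<lambda>k. addr_prob (m k) (n k)
        (\<lambda>h. no_inflow J b (m k) (n k) J h \<and> load_passage b (m k) (n k) J h l))
      \<longlonglongrightarrow> a * passage_weight b r l" (is ?B)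
proof -
  have "(\<lambda>k. addr_prob (m k) (n k) (\<lambda>h. bucket_loads (n k) h 0 J \<in> no_inflow_lists b J)) \<longlonglongrightarrow> a"
    unfolding a_def
    by (intro addr_prob_bucket_loads_tendsto[OF m n r] finite_no_inflow_lists)
      (simp add: no_inflow_lists_def)
  moreover have "eventually (\<lambda>k. addr_prob (m k) (n k) (\<lambda>h. bucket_loads (n k) h 0 J \<in> no_inflow_lists b J)
      = addr_prob (m k) (n k) (no_inflow J b (m k) (n k) J)) sequentially"
    using filterlim_at_top[THEN iffD1, OF m, rule_format, of J]
    by eventually_elim (rule addr_prob_cong, simp add: no_inflow_iff_lists)
  ultimately show ?A by (rule Lim_transform_eventually)
  define X where "X = (\<lambda>(ys, zs). ys @ zs) ` (no_inflow_lists b J \<times> passage_lists b l)"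
  have len: "length ys = J" if "ys \<in> no_inflow_lists b J" for ys
    using that by (simp add: no_inflow_lists_def)
  have len': "length zs = l" if "zs \<in> passage_lists b l" for zs
    using that by (simp add: passage_lists_def)
  \<comment> \<open>All prefixes have length \<open>J\<close>, so a concatenated list splits in only
    one way.\<close>
  have inj: "inj_on (\<lambda>(ys, zs). ys @ zs) (no_inflow_lists b J \<times> passage_lists b l)"
    by (auto simp: inj_on_def len append_eq_append_conv)
  have "(\<Sum>xs\<in>X. poisson_weight r xs)
      = (\<Sum>p\<in>no_inflow_lists b J \<times> passage_lists b l. poisson_weight r (fst p @ snd p))"
    unfolding X_def by (subst sum.reindex[OF inj]) (simp add: case_prod_beta)
  also have "\<dots> = a * passage_weight b r l"
    by (simp add: a_def passage_weight_def poisson_weight_def sum_product sum.cartesian_product case_prod_beta)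
  finally have sum: "(\<Sum>xs\<in>X. poisson_weight r xs) = a * passage_weight b r l" .
  have "(\<lambda>k. addr_prob (m k) (n k) (\<lambda>h. bucket_loads (n k) h 0 (J + l) \<in> X)) \<longlonglongrightarrow> (\<Sum>xs\<in>X. poisson_weight r xs)"
    by (intro addr_prob_bucket_loads_tendsto[OF m n r])
      (auto simp: X_def finite_no_inflow_lists finite_passage_lists len len')
  moreover have "eventually (\<lambda>k. addr_prob (m k) (n k) (\<lambda>h. bucket_loads (n k) h 0 (J + l) \<in> X)
      = addr_prob (m k) (n k) (\<lambda>h. no_inflow J b (m k) (n k) J h \<and> load_passage b (m k) (n k) J h l)) sequentially"
    using filterlim_at_top[THEN iffD1, OF m, rule_format, of "J + l"]
  proof eventually_elim
    case (elim k)
    have "bucket_loads (n k) h 0 (J + l) \<in> X \<longleftrightarrow>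
        no_inflow J b (m k) (n k) J h \<and> load_passage b (m k) (n k) J h l" for h
    proof -
      have "bucket_loads (n k) h 0 (J + l) = bucket_loads (n k) h 0 J @ bucket_loads (n k) h J (J + l)"
        by (rule bucket_loads_append) auto
      then have "bucket_loads (n k) h 0 (J + l) \<in> X \<longleftrightarrow>
          bucket_loads (n k) h 0 J \<in> no_inflow_lists b J \<and> bucket_loads (n k) h J (J + l) \<in> passage_lists b l"
        by (auto simp: X_def image_iff len append_eq_append_conv)
      then show ?thesis using elim by (simp add: no_inflow_iff_lists load_passage_iff_lists)
    qed
    then show ?case by (intro addr_prob_cong)
  qed
  ultimately show ?B unfolding sum by (rule Lim_transform_eventually)
qed

section \<open>Convergence of the block length\<close>

lemma no_inflow_antimono: "J \<le> J' \<Longrightarrow> no_inflow J' b m n s h \<Longrightarrow> no_inflow J b m n s h"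
  by (auto simp: no_inflow_def)

text \<open>If the truncated condition holds but the full one fails, some arc of more than
  \<open>J\<close> buckets is overloaded; a union bound gives a geometric tail. The event
  \<open>Q\<close> is arbitrary so that numerator and denominator of the conditional probability are
  both covered.\<close>

lemma truncation_error:
  assumes "0 < \<beta>" "\<beta> < 1" "1 \<le> b" "0 < m" "real n \<le> \<beta> * (real b * real m)"
  shows "addr_prob m n (\<lambda>h. no_inflow J b m n s h \<and> Q h)
    \<le> addr_prob m n (\<lambda>h. no_inflow m b m n s h \<and> Q h)
      + overload_rate \<beta> b ^ Suc J / (1 - overload_rate \<beta> b)"
proof -
  define \<rho> where "\<rho> = overload_rate \<beta> b"
  have \<rho>: "0 < \<rho>" "\<rho> < 1" using overload_rate_pos overload_rate_less_1 assms by (auto simp: \<rho>_def)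
  have "addr_prob m n (\<lambda>h. no_inflow J b m n s h \<and> Q h)
      \<le> addr_prob m n (\<lambda>h. (no_inflow m b m n s h \<and> Q h)
          \<or> (\<exists>j\<in>{Suc J..m}. b * j \<le> load n h (bucket_arc m (s + m - j) j)))"
  proof (rule addr_prob_mono)
    fix h assume h: "no_inflow J b m n s h \<and> Q h"
    have "no_inflow m b m n s h" if "\<forall>j\<in>{Suc J..m}. load n h (bucket_arc m (s + m - j) j) < b * j"
      unfolding no_inflow_def
    proof (intro allI impI)
      fix j assume "1 \<le> j" "j \<le> m"
      then show "load n h (bucket_arc m (s + m - j) j) < b * j"
        using h that by (cases "j \<le> J") (auto simp: no_inflow_def)
    qed
    then show "(no_inflow m b m n s h \<and> Q h)
        \<or> (\<exists>j\<in>{Suc J..m}. b * j \<le> load n h (bucket_arc m (s + m - j) j))"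
      using h by (meson not_le)
  qed
  also have "\<dots> \<le> addr_prob m n (\<lambda>h. no_inflow m b m n s h \<and> Q h)
      + addr_prob m n (\<lambda>h. \<exists>j\<in>{Suc J..m}. b * j \<le> load n h (bucket_arc m (s + m - j) j))"
    by (rule addr_prob_disj)
  also have "addr_prob m n (\<lambda>h. \<exists>j\<in>{Suc J..m}. b * j \<le> load n h (bucket_arc m (s + m - j) j))
      \<le> (\<Sum>j\<in>{Suc J..m}. \<rho> ^ j)"
    unfolding \<rho>_def
    by (rule order_trans[OF addr_prob_Bex sum_mono[OF addr_prob_overload]]) (use assms in auto)
  also have "\<dots> \<le> \<rho> ^ Suc J / (1 - \<rho>)"
  proof (cases "Suc J \<le> m")
    case True
    then have "(\<Sum>j\<in>{Suc J..m}. \<rho> ^ j) = (\<rho> ^ Suc J - \<rho> ^ Suc m) / (1 - \<rho>)"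
      using \<rho> by (simp add: sum_gp)
    also have "\<dots> \<le> \<rho> ^ Suc J / (1 - \<rho>)" using \<rho> by (intro divide_right_mono) auto
    finally show ?thesis .
  qed (use \<rho> in simp)
  finally show ?thesis by (simp add: \<rho>_def)
qed

text \<open>The quotient \<open>N / D\<close> is compared with \<open>q\<close> through
  \<open>N - q D\<close>. For the truncated quantities this difference tends to
  \<open>a q - q a = 0\<close>, whatever \<open>a\<close> is; truncation costs an error uniform in
  \<open>k\<close>, and \<open>D\<close> is at least \<open>1 - \<beta>\<close>.\<close>

lemma pmf_block_length_tendsto:
  fixes m n :: "nat \<Rightarrow> nat"
  assumes b: "1 \<le> b" and \<alpha>: "0 < \<alpha>" "\<alpha> < 1"
    and m: "filterlim m at_top sequentially" and n: "filterlim n at_top sequentially"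
    and room: "\<And>k. n k < b * m k"
    and lim: "(\<lambda>k. real (n k) / (real b * real (m k))) \<longlonglongrightarrow> \<alpha>"
  shows "(\<lambda>k. pmf (block_length_pmf b (m k) (n k)) l) \<longlonglongrightarrow> passage_weight b (\<alpha> * real b) l"
proof -
  define q where "q = passage_weight b (\<alpha> * real b) l"
  \<comment> \<open>A bound on the load factor, valid for all large \<open>k\<close>, that leaves
    room on both sides.\<close>
  obtain \<beta> where \<beta>: "\<alpha> < \<beta>" "\<beta> < 1" using \<alpha> dense by blast
  define \<rho> where "\<rho> = overload_rate \<beta> b"
  have \<rho>: "0 < \<rho>" "\<rho> < 1"
    using overload_rate_pos overload_rate_less_1 \<alpha> \<beta> b by (auto simp: \<rho>_def)
  have mpos: "0 < m k" for k using room[of k] by (auto intro: gr0I)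
  have q0: "0 \<le> q" unfolding q_def passage_weight_def poisson_weight_def
    using \<alpha> by (intro sum_nonneg prod_list_nonneg) auto
  have "(\<lambda>k. real b * (real (n k) / (real b * real (m k)))) \<longlonglongrightarrow> real b * \<alpha>"
    by (intro tendsto_mult lim tendsto_const)
  then have r: "(\<lambda>k. real (n k) / real (m k)) \<longlonglongrightarrow> \<alpha> * real b"
    using b by (simp add: mult.commute)
  have load: "eventually (\<lambda>k. real (n k) / (real b * real (m k)) < \<beta>) sequentially"
    using order_tendstoD(2)[OF lim \<beta>(1)] .
  \<comment> \<open>Replacing \<open>N'\<close> by \<open>N\<close> costs one geometric tail and
    replacing \<open>D'\<close> by \<open>D\<close> costs \<open>q\<close> of them; the sum is
    divided by the lower bound \<open>1 - \<beta>\<close> of \<open>D\<close>.\<close>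
  define err where "err J = (1 + q) * (\<rho> ^ Suc J / (1 - \<rho>)) / (1 - \<beta>)" for J
  have "(\<lambda>J. \<rho> ^ Suc J) \<longlonglongrightarrow> 0"
    using \<rho> by (intro LIMSEQ_Suc LIMSEQ_power_zero) auto
  then have "(\<lambda>J. (1 + q) * (\<rho> ^ Suc J / (1 - \<rho>)) / (1 - \<beta>)) \<longlonglongrightarrow> (1 + q) * (0 / (1 - \<rho>)) / (1 - \<beta>)"
    using \<rho> \<beta> by (intro tendsto_divide tendsto_mult tendsto_const) auto
  then have err0: "err \<longlonglongrightarrow> 0" by (simp add: err_def[abs_def])
  show ?thesis
    unfolding q_def[symmetric]
  proof (rule tendstoI)
    fix e :: real assume e: "0 < e"
    have "eventually (\<lambda>J. err J < e / 2) sequentially"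
      using order_tendstoD(2)[OF err0, of "e / 2"] e by simp
    then obtain J where J: "err J < e / 2" by (auto simp: eventually_sequentially)
    \<comment> \<open>The start is free in \<open>pmf_block_length\<close>; it is taken to be
      \<open>J\<close>, where the truncated events are intervals of buckets.\<close>
    define D where "D k = addr_prob (m k) (n k) (no_inflow (m k) b (m k) (n k) J)" for k
    define D' where "D' k = addr_prob (m k) (n k) (no_inflow J b (m k) (n k) J)" for k
    define N where "N k = addr_prob (m k) (n k)
      (\<lambda>h. no_inflow (m k) b (m k) (n k) J h \<and> load_passage b (m k) (n k) J h l)" for k
    define N' where "N' k = addr_prob (m k) (n k)
      (\<lambda>h. no_inflow J b (m k) (n k) J h \<and> load_passage b (m k) (n k) J h l)" for k
    define a where "a = (\<Sum>xs\<in>no_inflow_lists b J. poisson_weight (\<alpha> * real b) xs)"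
    have "D' \<longlonglongrightarrow> a" "N' \<longlonglongrightarrow> a * q"
      unfolding D'_def[abs_def] N'_def[abs_def] a_def q_def
      using truncated_no_inflow_tendsto[OF m n r] by blast+
    then have "(\<lambda>k. N' k - q * D' k) \<longlonglongrightarrow> a * q - q * a"
      by (intro tendsto_diff tendsto_mult tendsto_const)
    then have "(\<lambda>k. N' k - q * D' k) \<longlonglongrightarrow> 0" by (simp add: mult.commute)
    then have "eventually (\<lambda>k. dist (N' k - q * D' k) 0 < (1 - \<beta>) * (e / 2)) sequentially"
      using e \<beta> by (intro tendstoD) simp_all
    then have "eventually (\<lambda>k. \<bar>N' k - q * D' k\<bar> < (1 - \<beta>) * (e / 2)) sequentially"
      by (simp only: dist_real_def diff_0_right)
    then show "eventually (\<lambda>k. dist (pmf (block_length_pmf b (m k) (n k)) l) q < e) sequentially"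
      using load filterlim_at_top[THEN iffD1, OF m, rule_format, of J]
    proof eventually_elim
      case (elim k)
      have le: "real (n k) \<le> \<beta> * (real b * real (m k))"
        using elim(2) b mpos[of k] by (simp add: field_simps)
      have D: "1 - \<beta> \<le> D k"
        using no_inflow_prob_ge[OF room[of k], of J] elim(2) by (simp add: D_def)
      have pos: "0 < D k" using D \<beta> by simp
      have "N' k \<le> N k + \<rho> ^ Suc J / (1 - \<rho>)" "D' k \<le> D k + \<rho> ^ Suc J / (1 - \<rho>)"
        unfolding N_def N'_def D_def D'_def \<rho>_def
        using truncation_error[of \<beta> b "m k" "n k" J J] truncation_error[of \<beta> b "m k" "n k" J J "\<lambda>_. True"]
          \<alpha> \<beta> b mpos[of k] le by auto
      moreover have "N k \<le> N' k" "D k \<le> D' k"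
        unfolding N_def N'_def D_def D'_def
        using no_inflow_antimono[OF elim(3)] by (auto intro!: addr_prob_mono)
      ultimately have "\<bar>N k - N' k\<bar> \<le> \<rho> ^ Suc J / (1 - \<rho>)" "\<bar>D' k - D k\<bar> \<le> \<rho> ^ Suc J / (1 - \<rho>)"
        by linarith+
      then have "\<bar>N k - N' k\<bar> + \<bar>N' k - q * D' k\<bar> + q * \<bar>D' k - D k\<bar>
          < \<rho> ^ Suc J / (1 - \<rho>) + (1 - \<beta>) * (e / 2) + q * (\<rho> ^ Suc J / (1 - \<rho>))"
        using elim(1) mult_left_mono[OF _ q0, of "\<bar>D' k - D k\<bar>" "\<rho> ^ Suc J / (1 - \<rho>)"] by linarith
      also have "\<dots> = (1 - \<beta>) * (err J + e / 2)"
      proof -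
        have "(1 - \<beta>) * err J = (1 + q) * (\<rho> ^ Suc J / (1 - \<rho>))" using \<beta> by (simp add: err_def)
        then show ?thesis by (simp only: distrib_left distrib_right mult_1_left)
      qed
      also have "\<dots> < (1 - \<beta>) * e" using J \<beta> by (intro mult_strict_left_mono) auto
      also have "\<dots> \<le> D k * e" using D e by (intro mult_right_mono) auto
      finally have "\<bar>N k - N' k\<bar> + \<bar>N' k - q * D' k\<bar> + q * \<bar>D' k - D k\<bar> < D k * e" .
      moreover have "\<bar>q * (D' k - D k)\<bar> = q * \<bar>D' k - D k\<bar>" using q0 by (simp add: abs_mult)
      moreover have "N k - q * D k = (N k - N' k) + (N' k - q * D' k) + q * (D' k - D k)"
        by (simp add: algebra_simps)
      ultimately have "\<bar>N k - q * D k\<bar> < D k * e" by linarith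
      then have "\<bar>N k / D k - q\<bar> < e" using pos by (simp add: abs_if field_simps split: if_splits)
      then show ?case
        unfolding dist_real_def pmf_block_length[OF room, of k l J] N_def D_def .
    qed
  qed
qed

text \<open>A passage at \<open>l\<close> forces the first \<open>l - 1\<close> buckets to be
  overloaded, and conditioning costs at most \<open>1 / (1 - \<beta>)\<close>. The extra factor
  \<open>1 / overload_rate \<beta> b\<close> pays for the step from \<open>l - 1\<close> to
  \<open>l\<close>.\<close>

lemma pmf_block_length_le:
  assumes b: "1 \<le> b" and \<beta>: "0 < \<beta>" "\<beta> < 1"
    and room: "n < b * m" and le: "real n \<le> \<beta> * (real b * real m)"
  shows "pmf (block_length_pmf b m n) l
    \<le> overload_rate \<beta> b ^ l / (overload_rate \<beta> b * (1 - \<beta>))"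
proof -
  define \<rho> where "\<rho> = overload_rate \<beta> b"
  have \<rho>: "0 < \<rho>" "\<rho> < 1"
    using overload_rate_pos overload_rate_less_1 \<beta> b by (auto simp: \<rho>_def)
  have m: "0 < m" using room by (auto intro: gr0I)
  define D where "D = addr_prob m n (no_inflow m b m n 0)"
  define N where "N = addr_prob m n (\<lambda>h. no_inflow m b m n 0 h \<and> load_passage b m n 0 h l)"
  have "real n / (real b * real m) \<le> \<beta>" using le b m by (simp add: field_simps)
  then have D: "1 - \<beta> \<le> D" using no_inflow_prob_ge[OF room, of 0] by (simp add: D_def)
  have "N \<le> \<rho> ^ l / \<rho>"
  proof (cases "1 \<le> l \<and> l \<le> m")
    case True
    have "N \<le> addr_prob m n (\<lambda>h. b * (l - 1) \<le> load n h (bucket_arc m 0 (l - 1)))"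
      unfolding N_def using True by (intro addr_prob_mono) (cases "l = 1"; force simp: load_passage_def)
    also have "\<dots> \<le> \<rho> ^ (l - 1)"
      unfolding \<rho>_def using True \<beta> m le by (intro addr_prob_overload) auto
    also have "\<dots> = \<rho> ^ l / \<rho>" using True \<rho> by (simp add: power_diff)
    finally show ?thesis .
  next
    case False
    then have "N = 0" by (auto simp: N_def load_passage_def addr_prob_def)
    then show ?thesis using \<rho> by simp
  qed
  moreover have "pmf (block_length_pmf b m n) l = N / D"
    unfolding N_def D_def by (rule pmf_block_length[OF room])
  moreover have "N / D \<le> \<rho> ^ l / \<rho> / (1 - \<beta>)"
    using calculation D \<beta> \<rho> by (intro frac_le) auto
  ultimately show ?thesis by (simp add: \<rho>_def)
qed

lemma summable_polynomial_geometric: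
  fixes \<rho> :: real
  assumes "0 \<le> \<rho>" "\<rho> < 1"
  shows "summable (\<lambda>l. real l ^ r * \<rho> ^ l)"
proof -
  obtain c where c: "\<rho> < c" "c < 1" using assms dense by blast
  have "(\<lambda>l. (1 + 1 / real l) ^ r * \<rho>) \<longlonglongrightarrow> (1 + 0) ^ r * \<rho>"
    by (intro tendsto_intros lim_1_over_n)
  then have "eventually (\<lambda>l. (1 + 1 / real l) ^ r * \<rho> < c) sequentially"
    using c by (intro order_tendstoD) auto
  then obtain N where N: "\<And>l. l \<ge> N \<Longrightarrow> (1 + 1 / real l) ^ r * \<rho> < c"
    by (auto simp: eventually_sequentially)
  show ?thesis
  \<comment> \<open>Starting at \<open>Suc N\<close> excludes \<open>l = 0\<close>, where the ratio
    \<open>1 + 1 / real l\<close> would be wrong.\<close>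
  proof (rule summable_ratio_test[OF c(2), of "Suc N"])
    fix l assume l: "Suc N \<le> l"
    have "real (Suc l) = real l * (1 + 1 / real l)" using l by (simp add: field_simps)
    then have "real (Suc l) ^ r * \<rho> ^ Suc l = ((1 + 1 / real l) ^ r * \<rho>) * (real l ^ r * \<rho> ^ l)"
      by (simp add: power_mult_distrib)
    also have "\<dots> \<le> c * (real l ^ r * \<rho> ^ l)"
      using N[of l] l assms by (intro mult_right_mono) auto
    finally show "norm (real (Suc l) ^ r * \<rho> ^ Suc l) \<le> c * norm (real l ^ r * \<rho> ^ l)"
      using assms by simp
  qed
qed

text \<open>Turns integrals into series for the block-length law and for the limit law alike, so
  that both sides can be compared term by term.\<close>

lemma lebesgue_density_nat:
  fixes f p :: "nat \<Rightarrow> real"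
  assumes "\<And>l. 0 \<le> p l" "summable (\<lambda>l. norm (p l * f l))"
  shows "integrable (density (count_space UNIV) (\<lambda>l. ennreal (p l))) f"
    and "integral\<^sup>L (density (count_space UNIV) (\<lambda>l. ennreal (p l))) f = (\<Sum>l. p l * f l)"
proof -
  have i: "integrable (count_space UNIV) (\<lambda>l. p l *\<^sub>R f l)"
    using assms by (simp add: integrable_count_space_nat_iff)
  then show "integrable (density (count_space UNIV) (\<lambda>l. ennreal (p l))) f"
    using assms by (subst integrable_density) auto
  show "integral\<^sup>L (density (count_space UNIV) (\<lambda>l. ennreal (p l))) f = (\<Sum>l. p l * f l)"
    using assms integral_count_space_nat[OF i] by (subst integral_density) auto
qed

text \<open>Dominated convergence for series: for all large \<open>k\<close> the terms lie below one
  summable sequence, polynomial times geometric. With \<open>r = 0\<close> it covers bounded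
  functions, hence total mass and distribution functions; positive \<open>r\<close> gives the
  moments.\<close>

lemma block_length_expectation_tendsto:
  fixes m n :: "nat \<Rightarrow> nat" and f :: "nat \<Rightarrow> real"
  assumes b: "1 \<le> b" and \<alpha>: "0 < \<alpha>" "\<alpha> < 1"
    and m: "filterlim m at_top sequentially" and n: "filterlim n at_top sequentially"
    and room: "\<And>k. n k < b * m k"
    and lim: "(\<lambda>k. real (n k) / (real b * real (m k))) \<longlonglongrightarrow> \<alpha>"
    and f: "\<And>l. \<bar>f l\<bar> \<le> real l ^ r"
  shows "summable (\<lambda>l. norm (passage_weight b (\<alpha> * real b) l * f l))"
    and "(\<lambda>k. measure_pmf.expectation (block_length_pmf b (m k) (n k)) f)
      \<longlonglongrightarrow> (\<Sum>l. passage_weight b (\<alpha> * real b) l * f l)"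
proof -
  obtain \<beta> where \<beta>: "\<alpha> < \<beta>" "\<beta> < 1" using \<alpha> dense by blast
  define \<rho> where "\<rho> = overload_rate \<beta> b"
  have \<rho>: "0 < \<rho>" "\<rho> < 1"
    using overload_rate_pos overload_rate_less_1 \<alpha> \<beta> b by (auto simp: \<rho>_def)
  have mpos: "0 < m k" for k using room[of k] by (auto intro: gr0I)
  define B where "B l = real l ^ r * \<rho> ^ l * (1 / (\<rho> * (1 - \<beta>)))" for l
  have sumB: "summable B"
    unfolding B_def using \<rho> by (intro summable_mult2 summable_polynomial_geometric) auto
  let ?p = "\<lambda>k l. pmf (block_length_pmf b (m k) (n k)) l"
  have "eventually (\<lambda>k. real (n k) / (real b * real (m k)) < \<beta>) sequentially"
    using order_tendstoD(2)[OF lim \<beta>(1)] .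
  then have "eventually (\<lambda>k. \<forall>l. norm (?p k l * f l) \<le> B l) sequentially"
  proof eventually_elim
    case (elim k)
    have "real (n k) \<le> \<beta> * (real b * real (m k))"
      using elim b mpos[of k] by (simp add: field_simps)
    then have "?p k l \<le> \<rho> ^ l / (\<rho> * (1 - \<beta>))" for l
      unfolding \<rho>_def using \<alpha> \<beta> b room by (intro pmf_block_length_le) auto
    then have "?p k l * \<bar>f l\<bar> \<le> \<rho> ^ l / (\<rho> * (1 - \<beta>)) * real l ^ r" for l
      using f \<rho> \<beta> by (intro mult_mono) auto
    then show ?case by (simp add: B_def abs_mult mult_ac)
  qed
  \<comment> \<open>Tannery's theorem asks for domination along the product filter; here it holds
    for all \<open>l\<close> simultaneously.\<close>
  then have "eventually (\<lambda>(l, k). norm (?p k l * f l) \<le> B l) (at_top \<times>\<^sub>F sequentially)"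
    using eventually_prod2[of "at_top :: nat filter" "\<lambda>k. \<forall>l. norm (?p k l * f l) \<le> B l" sequentially]
    by (auto elim!: eventually_mono)
  moreover have "(\<lambda>k. ?p k l * f l) \<longlonglongrightarrow> passage_weight b (\<alpha> * real b) l * f l" for l
    using pmf_block_length_tendsto[OF b \<alpha> m n room lim] by (intro tendsto_mult tendsto_const)
  ultimately have T: "eventually (\<lambda>k. summable (\<lambda>l. norm (?p k l * f l))) sequentially"
    "summable (\<lambda>l. norm (passage_weight b (\<alpha> * real b) l * f l))"
    "(\<lambda>k. \<Sum>l. ?p k l * f l) \<longlonglongrightarrow> (\<Sum>l. passage_weight b (\<alpha> * real b) l * f l)"
    using tannerys_theorem[of "\<lambda>l k. ?p k l * f l" "\<lambda>l. passage_weight b (\<alpha> * real b) l * f l" sequentially B]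
      sumB by (simp_all only: trivial_limit_sequentially not_False_eq_True True_implies_equals)
  show "summable (\<lambda>l. norm (passage_weight b (\<alpha> * real b) l * f l))" by (rule T)
  have "eventually (\<lambda>k. (\<Sum>l. ?p k l * f l) = measure_pmf.expectation (block_length_pmf b (m k) (n k)) f) sequentially"
    using T(1)
    by eventually_elim (simp add: measure_pmf_eq_density lebesgue_density_nat(2))
  with T(3) show "(\<lambda>k. measure_pmf.expectation (block_length_pmf b (m k) (n k)) f)
      \<longlonglongrightarrow> (\<Sum>l. passage_weight b (\<alpha> * real b) l * f l)"
    by (rule Lim_transform_eventually)
qed

section \<open>The law of the limit variable\<close>

definition first_loads :: "(nat \<Rightarrow> 'a \<Rightarrow> nat) \<Rightarrow> 'a \<Rightarrow> nat \<Rightarrow> nat list" where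
  "first_loads X \<omega> l = map (\<lambda>j. X j \<omega>) [1..<Suc l]"

lemma first_loads_in_passage_lists_iff:
  "first_loads X \<omega> l \<in> passage_lists b l \<longleftrightarrow>
    1 \<le> l \<and> (\<Sum>j = 1..l. X j \<omega>) < b * l \<and> (\<forall>i. 1 \<le> i \<longrightarrow> i < l \<longrightarrow> b * i \<le> (\<Sum>j = 1..i. X j \<omega>))"
proof -
  have sum: "sum_list (take i (first_loads X \<omega> l)) = (\<Sum>j = 1..i. X j \<omega>)" if "i \<le> l" for i
  proof -
    have "take i [1..<Suc l] = [1..<Suc i]" using that take_upt[of 1 i "Suc l"] by (simp del: upt_Suc)
    then show ?thesis unfolding first_loads_def
      by (simp add: take_map sum_list_distinct_conv_sum_set atLeastLessThanSuc_atLeastAtMost del: upt_Suc)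
  qed
  have len: "length (first_loads X \<omega> l) = l" by (simp add: first_loads_def)
  have all: "sum_list (first_loads X \<omega> l) = (\<Sum>j = 1..l. X j \<omega>)" using sum[of l] len by simp
  have "b * i \<le> sum_list (take i (first_loads X \<omega> l)) \<longleftrightarrow> b * i \<le> (\<Sum>j = 1..i. X j \<omega>)" if "i < l" for i
    using sum[of i] that by simp
  then show ?thesis unfolding passage_lists_def by (auto simp: len all)
qed

lemma B_lim_eq_passage:
  assumes "first_loads X \<omega> l \<in> passage_lists b l"
  shows "B_lim b X \<omega> = l"
  unfolding B_lim_def
proof (rule cInf_eq_minimum)
  show "l \<in> {i. 1 \<le> i \<and> (\<Sum>j = 1..i. X j \<omega>) < b * i}"
    using assms by (simp add: first_loads_in_passage_lists_iff)
  show "l \<le> i" if "i \<in> {i. 1 \<le> i \<and> (\<Sum>j = 1..i. X j \<omega>) < b * i}" for i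
    using assms that unfolding first_loads_in_passage_lists_iff by (metis mem_Collect_eq not_le)
qed

text \<open>The library leaves the infimum of the empty set of naturals unspecified.\<close>
lemma B_lim_no_passage:
  assumes "\<And>l. first_loads X \<omega> l \<notin> passage_lists b l"
  shows "B_lim b X \<omega> = Inf {}"
proof -
  let ?S = "{i. 1 \<le> i \<and> (\<Sum>j = 1..i. X j \<omega>) < b * i}"
  have "?S = {}"
  proof (rule ccontr)
    assume "?S \<noteq> {}"
    then have "(LEAST i. i \<in> ?S) \<in> ?S" by (metis (mono_tags, lifting) LeastI ex_in_conv)
    moreover have "i \<notin> ?S" if "i < (LEAST i. i \<in> ?S)" for i using not_less_Least[OF that] .
    ultimately have "first_loads X \<omega> (LEAST i. i \<in> ?S) \<in> passage_lists b (LEAST i. i \<in> ?S)"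
      unfolding first_loads_in_passage_lists_iff by (auto simp: not_less)
    with assms show False by blast
  qed
  then show ?thesis by (simp only: B_lim_def)
qed

context prob_space begin

text \<open>Only \<open>X 1, ..., X l\<close> matter, and the event is a finite disjoint union over
  load lists; independence turns each piece into a product of Poisson probabilities.\<close>

lemma passage_event:
  fixes X :: "nat \<Rightarrow> 'a \<Rightarrow> nat"
  assumes indep: "indep_vars (\<lambda>_. count_space UNIV) X {1..}"
    and distr: "\<And>i. 1 \<le> i \<Longrightarrow> distr M (count_space UNIV) (X i) = measure_pmf (poisson_pmf r)"
    and r: "0 < r"
  shows "{\<omega> \<in> space M. first_loads X \<omega> l \<in> passage_lists b l} \<in> events"
    and "prob {\<omega> \<in> space M. first_loads X \<omega> l \<in> passage_lists b l} = passage_weight b r l"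
proof -
  have [measurable]: "X i \<in> measurable M (count_space UNIV)" if "1 \<le> i" for i
    using indep that by (auto simp: indep_vars_def)
  define E where "E xs = {\<omega> \<in> space M. first_loads X \<omega> l = xs}" for xs
  have len: "length xs = l" "1 \<le> l" if "xs \<in> passage_lists b l" for xs
    using that by (simp_all add: passage_lists_def)
  have E: "E xs = (\<Inter>j\<in>{1..l}. X j -` {xs ! (j - 1)} \<inter> space M)" if "length xs = l" "1 \<le> l" for xs
  proof -
    have "first_loads X \<omega> l = xs \<longleftrightarrow> (\<forall>j\<in>{1..l}. X j \<omega> = xs ! (j - 1))" for \<omega>
    proof -
      have "first_loads X \<omega> l = xs \<longleftrightarrow> (\<forall>i<l. X (Suc i) \<omega> = xs ! i)"
        using that by (simp add: first_loads_def list_eq_iff_nth_eq del: upt_Suc)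
      also have "\<dots> \<longleftrightarrow> (\<forall>j\<in>{1..l}. X j \<omega> = xs ! (j - 1))"
      proof safe
        fix j assume *: "\<forall>i<l. X (Suc i) \<omega> = xs ! i" "j \<in> {1..l}"
        then show "X j \<omega> = xs ! (j - 1)" by (cases j) auto
      next
        fix i assume *: "\<forall>j\<in>{1..l}. X j \<omega> = xs ! (j - 1)" "i < l"
        then show "X (Suc i) \<omega> = xs ! i" using *(1)[rule_format, of "Suc i"] by simp
      qed
      finally show ?thesis .
    qed
    then show ?thesis using that by (auto simp: E_def)
  qed
  have Eev: "E xs \<in> events" if "xs \<in> passage_lists b l" for xs
    unfolding E[OF len[OF that]] using len[OF that] by (intro sets.finite_INT) auto
  have PE: "prob (E xs) = poisson_weight r xs" if "xs \<in> passage_lists b l" for xs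
  proof -
    have "prob (E xs) = (\<Prod>j\<in>{1..l}. prob (X j -` {xs ! (j - 1)} \<inter> space M))"
      unfolding E[OF len[OF that]] using len[OF that] by (intro indep_varsD[OF indep]) auto
    also have "\<dots> = (\<Prod>j\<in>{1..l}. r ^ (xs ! (j - 1)) / fact (xs ! (j - 1)) * exp (- r))"
    proof (rule prod.cong[OF refl])
      fix j assume j: "j \<in> {1..l}"
      have "prob (X j -` {xs ! (j - 1)} \<inter> space M) = measure (distr M (count_space UNIV) (X j)) {xs ! (j - 1)}"
        using j by (subst measure_distr) auto
      also have "\<dots> = pmf (poisson_pmf r) (xs ! (j - 1))"
        using j distr by (simp add: measure_pmf_single)
      finally show "prob (X j -` {xs ! (j - 1)} \<inter> space M) = r ^ (xs ! (j - 1)) / fact (xs ! (j - 1)) * exp (- r)"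
        using r by simp
    qed
    also have "\<dots> = (\<Prod>i<l. r ^ (xs ! i) / fact (xs ! i) * exp (- r))"
      by (rule prod.reindex_bij_witness[of _ Suc "\<lambda>j. j - 1"]) auto
    also have "\<dots> = poisson_weight r xs"
      unfolding poisson_weight_def prod.list_conv_set_nth using len[OF that] by (simp add: atLeast0LessThan)
    finally show ?thesis .
  qed
  have U: "{\<omega> \<in> space M. first_loads X \<omega> l \<in> passage_lists b l} = (\<Union>xs\<in>passage_lists b l. E xs)"
    unfolding E_def by blast
  show "{\<omega> \<in> space M. first_loads X \<omega> l \<in> passage_lists b l} \<in> events"
    unfolding U using Eev finite_passage_lists by blast
  have "prob (\<Union>xs\<in>passage_lists b l. E xs) = (\<Sum>xs\<in>passage_lists b l. prob (E xs))"
    using Eev finite_passage_lists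
    by (intro finite_measure_finite_Union) (auto simp: disjoint_family_on_def E_def)
  also have "\<dots> = passage_weight b r l"
    unfolding passage_weight_def using PE by (intro sum.cong) auto
  finally show "prob {\<omega> \<in> space M. first_loads X \<omega> l \<in> passage_lists b l} = passage_weight b r l"
    by (simp add: U)
qed

text \<open>The passage events are disjoint with probabilities summing to 1, so they exhaust the
  space up to a null set.\<close>

lemma B_lim_distr:
  fixes X :: "nat \<Rightarrow> 'a \<Rightarrow> nat"
  assumes X: "indep_vars (\<lambda>_. count_space UNIV) X {1..}"
    "\<And>i. 1 \<le> i \<Longrightarrow> distr M (count_space UNIV) (X i) = measure_pmf (poisson_pmf r)" "0 < r"
    and total: "passage_weight b r sums 1"
  shows "B_lim b X \<in> measurable M (count_space UNIV)"
    and "distr M (count_space UNIV) (B_lim b X)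
      = density (count_space UNIV) (\<lambda>l. ennreal (passage_weight b r l))"
proof -
  define P where "P l = {\<omega> \<in> space M. first_loads X \<omega> l \<in> passage_lists b l}" for l
  define N where "N = space M - (\<Union>l. P l)"
  have P: "P l \<in> events" "prob (P l) = passage_weight b r l" for l
    using passage_event[OF X] by (simp_all add: P_def)
  have Pl: "B_lim b X \<omega> = l" if "\<omega> \<in> P l" for \<omega> l
    using that unfolding P_def by (intro B_lim_eq_passage) simp
  have N: "N \<in> events" unfolding N_def using P by auto
  have "disjoint_family P" unfolding disjoint_family_on_def using Pl by blast
  then have "(\<lambda>l. prob (P l)) sums prob (\<Union>l. P l)"
    using P by (intro finite_measure_UNION) auto
  then have "prob (\<Union>l. P l) = 1" using total sums_unique2 by (simp add: P) blast
  then have N0: "prob N = 0" unfolding N_def using P by (subst prob_compl) auto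
  \<comment> \<open>On \<open>N\<close> no passage occurs and \<open>B_lim\<close> is
    \<open>Inf {}\<close>, whichever natural that is. Hence exactly one preimage is enlarged, by a
    null set.\<close>
  have eq: "B_lim b X -` {l} \<inter> space M = P l \<union> (if Inf {} = l then N else {})" for l
  proof -
    have NB: "B_lim b X \<omega> = Inf {}" if "\<omega> \<in> N" for \<omega>
      using that by (intro B_lim_no_passage) (auto simp: N_def P_def)
    have PS: "P l \<subseteq> space M" "N \<subseteq> space M" by (auto simp: P_def N_def)
    have "\<omega> \<in> P l \<union> (if Inf {} = l then N else {})" if B: "\<omega> \<in> space M" "B_lim b X \<omega> = l" for \<omega>
    proof (cases "\<omega> \<in> N")
      case False
      then obtain l' where "\<omega> \<in> P l'" using B by (auto simp: N_def)
      then show ?thesis using Pl B by blast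
    qed (use NB B in auto)
    moreover have "\<omega> \<in> B_lim b X -` {l} \<inter> space M" if "\<omega> \<in> P l \<union> (if Inf {} = l then N else {})" for \<omega>
      using that Pl NB PS by (auto split: if_splits)
    ultimately show ?thesis by blast
  qed
  have ev: "B_lim b X -` {l} \<inter> space M \<in> events" for l
    unfolding eq using P N by auto
  then show meas: "B_lim b X \<in> measurable M (count_space UNIV)"
    by (simp add: measurable_count_space_eq_countable)
  have pr: "prob (B_lim b X -` {l} \<inter> space M) = passage_weight b r l" for l
  proof -
    have "prob (P l) \<le> prob (B_lim b X -` {l} \<inter> space M)"
      using ev[of l] unfolding eq by (intro finite_measure_mono) auto
    moreover have "prob (B_lim b X -` {l} \<inter> space M) \<le> prob (P l \<union> N)"
      unfolding eq using P N by (intro finite_measure_mono) auto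
    moreover have "prob (P l \<union> N) \<le> prob (P l) + prob N"
      using P N by (intro measure_Un_le) auto
    ultimately show ?thesis using N0 P by simp
  qed
  show "distr M (count_space UNIV) (B_lim b X)
      = density (count_space UNIV) (\<lambda>l. ennreal (passage_weight b r l))"
  proof (rule measure_eqI_countable[of _ UNIV])
    fix l :: nat
    show "emeasure (distr M (count_space UNIV) (B_lim b X)) {l}
      = emeasure (density (count_space UNIV) (\<lambda>l. ennreal (passage_weight b r l))) {l}"
      using meas by (simp add: emeasure_distr emeasure_eq_measure pr emeasure_density)
  qed auto
qed

end

theorem theorem10p12:
  fixes b :: nat and \<alpha> :: real and m n :: "nat \<Rightarrow> nat"
    and M :: "'a measure" and X :: "nat \<Rightarrow> 'a \<Rightarrow> nat"
  assumes "b \<ge> 1" and "0 < \<alpha>" and "\<alpha> < 1"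
    and "prob_space M"
    and "prob_space.indep_vars M (\<lambda>_. count_space UNIV) X {1..}"
    and "\<And>i. i \<ge> 1 \<Longrightarrow> distr M (count_space UNIV) (X i) = measure_pmf (poisson_pmf (\<alpha> * real b))"
    and "filterlim m at_top sequentially" and "filterlim n at_top sequentially"
    and "\<And>k. n k < b * m k"
    and "(\<lambda>k. real (n k) / (real b * real (m k))) \<longlonglongrightarrow> \<alpha>"
  shows "(AE \<omega> in M. B_lim b X \<omega> \<ge> 1)
    \<and> weak_conv_m (\<lambda>k. distr (measure_pmf (block_length_pmf b (m k) (n k))) borel real)
                   (distr M borel (\<lambda>\<omega>. real (B_lim b X \<omega>)))
    \<and> (\<forall>r::nat. integrable M (\<lambda>\<omega>. real (B_lim b X \<omega>) ^ r)
         \<and> (\<lambda>k. measure_pmf.expectation (block_length_pmf b (m k) (n k)) (\<lambda>l. real l ^ r))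
             \<longlonglongrightarrow> prob_space.expectation M (\<lambda>\<omega>. real (B_lim b X \<omega>) ^ r))"
proof -
  interpret prob_space M by fact
  define q where "q = passage_weight b (\<alpha> * real b)"
  let ?B = "B_lim b X" and ?p = "\<lambda>k. block_length_pmf b (m k) (n k)"
  have q0: "0 \<le> q l" for l unfolding q_def passage_weight_def poisson_weight_def
    using assms(1-3) by (intro sum_nonneg prod_list_nonneg) auto
  note lim = block_length_expectation_tendsto[OF assms(1-3,7-10), folded q_def]
  \<comment> \<open>With the constant function 1 every expectation before the limit equals 1, so the
    limiting weights sum to 1: domination prevents mass from escaping to infinity.\<close>
  have "summable q" using lim(1)[of "\<lambda>_. 1" 0] q0 by simp
  moreover have "suminf q = 1"
    using lim(2)[of "\<lambda>_. 1" 0] by (simp add: LIMSEQ_const_iff)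
  ultimately have total: "q sums 1" by (simp add: sums_iff)
  have r: "0 < \<alpha> * real b" using assms(1,2) by simp
  have meas[measurable]: "?B \<in> measurable M (count_space UNIV)"
    and law: "distr M (count_space UNIV) ?B = density (count_space UNIV) (\<lambda>l. ennreal (q l))"
    using B_lim_distr[OF assms(5,6) r, of b] total unfolding q_def by simp_all
  have main: "integrable M (\<lambda>\<omega>. f (?B \<omega>))"
      "(\<lambda>k. measure_pmf.expectation (?p k) f) \<longlonglongrightarrow> expectation (\<lambda>\<omega>. f (?B \<omega>))"
    if f: "\<And>l. \<bar>f l\<bar> \<le> real l ^ r" for f :: "nat \<Rightarrow> real" and r
  proof -
    have "integrable (distr M (count_space UNIV) ?B) f" unfolding law
      by (intro lebesgue_density_nat q0 lim(1)[OF f])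
    then show "integrable M (\<lambda>\<omega>. f (?B \<omega>))" by (simp add: integrable_distr_eq)
    have "integral\<^sup>L (distr M (count_space UNIV) ?B) f = (\<Sum>l. q l * f l)" unfolding law
      by (intro lebesgue_density_nat q0 lim(1)[OF f])
    then have "expectation (\<lambda>\<omega>. f (?B \<omega>)) = (\<Sum>l. q l * f l)" by (simp add: integral_distr)
    then show "(\<lambda>k. measure_pmf.expectation (?p k) f) \<longlonglongrightarrow> expectation (\<lambda>\<omega>. f (?B \<omega>))"
      using lim(2)[OF f] by simp
  qed
  \<comment> \<open>Passage lists have positive length, so the limit law gives no mass to 0.\<close>
  have "q 0 = 0" by (simp add: q_def passage_weight_def passage_lists_def)
  then have "1 \<le> l" if "0 < q l" for l using that by (cases l) auto
  then have "AE l in distr M (count_space UNIV) ?B. 1 \<le> l"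
    unfolding law by (subst AE_density) (auto simp: AE_count_space)
  then have "AE \<omega> in M. 1 \<le> ?B \<omega>" by (simp add: AE_distr_iff)
  moreover have "weak_conv_m (\<lambda>k. distr (measure_pmf (?p k)) borel real)
      (distr M borel (\<lambda>\<omega>. real (?B \<omega>)))"
    unfolding weak_conv_m_def weak_conv_def
  proof (intro allI impI)
    fix x :: real
    \<comment> \<open>The distribution function at \<open>x\<close> is the expectation of this
      indicator, which is bounded by \<open>real l ^ 0\<close>.\<close>
    let ?f = "indicator {l. real l \<le> x} :: nat \<Rightarrow> real"
    have "cdf (distr (measure_pmf p) borel real) x = measure_pmf.expectation p ?f" for p
      by (simp add: cdf_def measure_distr vimage_def)
    moreover have "cdf (distr M borel (\<lambda>\<omega>. real (?B \<omega>))) x = expectation (\<lambda>\<omega>. ?f (?B \<omega>))"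
    proof -
      have "(\<lambda>\<omega>. real (?B \<omega>)) \<in> borel_measurable M" by measurable
      then have "cdf (distr M borel (\<lambda>\<omega>. real (?B \<omega>))) x = prob {\<omega> \<in> space M. real (?B \<omega>) \<le> x}"
        by (simp add: cdf_def measure_distr vimage_def Int_def conj_commute)
      also have "\<dots> = expectation (indicator {\<omega> \<in> space M. real (?B \<omega>) \<le> x})" by simp
      also have "\<dots> = expectation (\<lambda>\<omega>. ?f (?B \<omega>))"
        by (rule Bochner_Integration.integral_cong) (auto simp: indicator_def)
      finally show ?thesis .
    qed
    moreover have "(\<lambda>k. measure_pmf.expectation (?p k) ?f) \<longlonglongrightarrow> expectation (\<lambda>\<omega>. ?f (?B \<omega>))"
      by (rule main(2)[of _ 0]) (simp add: indicator_def)
    ultimately show "(\<lambda>k. cdf (distr (measure_pmf (?p k)) borel real) x)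
        \<longlonglongrightarrow> cdf (distr M borel (\<lambda>\<omega>. real (?B \<omega>))) x" by simp
  qed
  moreover have "integrable M (\<lambda>\<omega>. real (?B \<omega>) ^ r)
      \<and> (\<lambda>k. measure_pmf.expectation (?p k) (\<lambda>l. real l ^ r)) \<longlonglongrightarrow> expectation (\<lambda>\<omega>. real (?B \<omega>) ^ r)" for r
    using main[of "\<lambda>l. real l ^ r" r] by simp
  ultimately show ?thesis by blast
qed

end
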